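(* Let $p\in(1,\infty]$ and let $X$ be a $p$-AUS Banach space. If a Banach space $Y$ is asymptotically coarse Lipschitz equivalent to $X$, then $Y$ is $p'$-AUSable for all $p'\in(1,p)$.
   Context: For a Banach space $X$, $S_X$ is its unit sphere and $\mathrm{cof}(X)$ is the set of its closed finite codimensional subspaces. The modulus of asymptotic uniform smoothness of $X$ is $$\bar\rho_X(\tau)=\sup_{x\in S_X}\inf_{Y\in \mathrm{cof}(X)}\sup_{y\in S_Y}\|x+\tau y\|-1,\qquad \tau\ge 0.$$ For $p\in(1,\infty)$, $X$ is $p$-AUS ($p$-asymptotically uniformly smooth) if there is $C>0$ such that $\bar\rho_X(\tau)\le C\tau^p$ for all $\tau\in(0,1)$. $X$ is $\infty$-AUS if there is $\tau_0>0$ such that $\bar\rho_X(\tau)=0$ for all $\tau<\tau_0$. $X$ is $p$-AUSable if it admits an equivalent norm for which it is $p$-AUS. Banach spaces are regarded as metric spaces with the metric $d(x,x')=\|x-x'\|$. Let $(X,d)$ and $(Y,\partial)$ be metric spaces. A map $f:X\to Y$ is coarse Lipschitz if there is $L>0$ such that $\partial(f(x),f(x'))\le L\,d(x,x')+L$ for all $x,x'\in X$. Two maps $f,g:X\to Y$ are asymptotically close, written $f\sim_\infty g$, if for some $x_0\in X$ one has $\lim_{x\to\infty}\frac{\partial(f(x),g(x))}{d(x,x_0)}=0$, where $x\to\infty$ means $d(x,x_0)\to\infty$; if $X$ is bounded, any two maps $X\to Y$ are by convention asymptotically close. $X$ and $Y$ are asymptotically coarse Lipschitz equivalent if there are coarse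 Lipschitz maps $f:X\to Y$ and $g:Y\to X$ with $g\circ f\sim_\infty \mathrm{Id}_X$ and $f\circ g\sim_\infty \mathrm{Id}_Y$. *)

theory Defs
  imports "HOL-Analysis.Analysis"
begin

section \<open>Asymptotic uniform smoothness\<close>

text \<open>
  Renormings of a Banach space are functions \<open>N :: 'a \<Rightarrow> real\<close>; the original norm is
  \<open>norm\<close>.
\<close>

definition equivalent_norm :: "('a::real_normed_vector \<Rightarrow> real) \<Rightarrow> bool" where
  "equivalent_norm N \<longleftrightarrow>
     (\<forall>x. N x = 0 \<longleftrightarrow> x = 0) \<and>
     (\<forall>x y. N (x + y) \<le> N x + N y) \<and>
     (\<forall>c x. N (c *\<^sub>R x) = \<bar>c\<bar> * N x) \<and>
     (\<exists>a>0. \<exists>b>0. \<forall>x. a * norm x \<le> N x \<and> N x \<le> b * norm x)"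

text \<open>
  Equivalent norms induce the same topology, so the closed subspaces below, taken with respect to
  the original norm, are also those of any equivalent norm.
\<close>

definition cof :: "'a::real_normed_vector set set" where
  "cof = {Y. subspace Y \<and> closed Y \<and> (\<exists>F. finite F \<and> span (Y \<union> F) = UNIV)}"

definition unit_sphere_on :: "('a::real_normed_vector \<Rightarrow> real) \<Rightarrow> 'a set \<Rightarrow> 'a set" where
  "unit_sphere_on N Y = {y \<in> Y. N y = 1}"

definition finite_dim_space :: "'a::real_vector itself \<Rightarrow> bool" where
  "finite_dim_space _ \<longleftrightarrow> (\<exists>F :: 'a set. finite F \<and> span F = UNIV)"

text \<open>
  On a finite-dimensional space \<open>{0}\<close> is finite codimensional and has empty unit sphere, so the
  supremum in the formula for the modulus is degenerate; the modulus is then \<open>0\<close> by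
  convention. On an infinite-dimensional space every finite codimensional subspace has a nonempty
  unit sphere, and when \<open>N\<close> is an equivalent norm all the suprema and infima are over nonempty
  bounded sets of reals.
\<close>

definition aus_modulus :: "('a::real_normed_vector \<Rightarrow> real) \<Rightarrow> real \<Rightarrow> real" where
  "aus_modulus N \<tau> =
     (if finite_dim_space TYPE('a) then 0
      else (SUP x\<in>unit_sphere_on N UNIV. INF Y\<in>cof. SUP y\<in>unit_sphere_on N Y. N (x + \<tau> *\<^sub>R y)) - 1)"

definition AUS :: "ereal \<Rightarrow> ('a::real_normed_vector \<Rightarrow> real) \<Rightarrow> bool" where
  "AUS p N \<longleftrightarrow>
     (if p = \<infinity> then \<exists>\<tau>\<^sub>0>0. \<forall>\<tau>\<in>{0..<\<tau>\<^sub>0}. aus_modulus N \<tau> = 0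
      else \<exists>C>0. \<forall>\<tau>\<in>{0<..<1}. aus_modulus N \<tau> \<le> C * \<tau> powr real_of_ereal p)"

definition AUSable :: "ereal \<Rightarrow> 'a::real_normed_vector itself \<Rightarrow> bool" where
  "AUSable p _ \<longleftrightarrow> (\<exists>N :: 'a \<Rightarrow> real. equivalent_norm N \<and> AUS p N)"

section \<open>Asymptotic coarse Lipschitz equivalence\<close>

definition coarse_lipschitz :: "('a::metric_space \<Rightarrow> 'b::metric_space) \<Rightarrow> bool" where
  "coarse_lipschitz f \<longleftrightarrow> (\<exists>L>0. \<forall>x x'. dist (f x) (f x') \<le> L * dist x x' + L)"

text \<open>
  The filter expresses \<open>dist x x\<^sub>0 \<rightarrow> \<infinity>\<close>. On a bounded space it is trivial, so any
  two maps are then asymptotically close, as shown below.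
\<close>

definition asymptotically_close ::
    "('a::metric_space \<Rightarrow> 'b::metric_space) \<Rightarrow> ('a \<Rightarrow> 'b) \<Rightarrow> bool" where
  "asymptotically_close f g \<longleftrightarrow>
     (\<exists>x\<^sub>0. ((\<lambda>x. dist (f x) (g x) / dist x x\<^sub>0) \<longlongrightarrow> 0)
            (filtercomap (\<lambda>x. dist x x\<^sub>0) at_top))"

lemma asymptotically_close_bounded:
  fixes f g :: "'a::metric_space \<Rightarrow> 'b::metric_space"
  assumes "bounded (UNIV :: 'a set)"
  shows "asymptotically_close f g"
proof -
  fix x\<^sub>0 :: 'a
  obtain e where e: "dist x x\<^sub>0 \<le> e" for x
    using assms unfolding bounded_any_center[of _ x\<^sub>0] by (auto simp: dist_commute)
  have "eventually (\<lambda>x. False) (filtercomap (\<lambda>x. dist x x\<^sub>0) at_top)"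
    unfolding eventually_filtercomap
    by (rule exI[of _ "\<lambda>r. e < r"]) (use e in \<open>auto simp: eventually_gt_at_top not_less\<close>)
  then have "filtercomap (\<lambda>x. dist x x\<^sub>0) at_top = bot"
    by (simp add: trivial_limit_def)
  then show ?thesis
    unfolding asymptotically_close_def by (intro exI[of _ x\<^sub>0]) simp
qed

definition asymptotically_coarse_lipschitz_equivalent ::
    "'a::metric_space itself \<Rightarrow> 'b::metric_space itself \<Rightarrow> bool" where
  "asymptotically_coarse_lipschitz_equivalent _ _ \<longleftrightarrow>
     (\<exists>(f :: 'a \<Rightarrow> 'b) (g :: 'b \<Rightarrow> 'a). coarse_lipschitz f \<and> coarse_lipschitz g \<and>
        asymptotically_close (g \<circ> f) id \<and> asymptotically_close (f \<circ> g) id)"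

end

theory Submission
  imports Defs
begin

text \<open>
  Let \<open>F : X \<rightarrow> Y\<close> and \<open>G : Y \<rightarrow> X\<close> realise the equivalence. On the dual of \<open>Y\<close> consider the
  functions sending \<open>\<phi>\<close> to the supremum of \<open>\<phi> (F x - F x') / norm (x - x')\<close> over \<open>x, x'\<close> in a
  large ball at distance at least \<open>\<theta>\<close>. They are weak-* lower semicontinuous and uniformly
  equivalent to the dual norm. By asymptotic smoothness of \<open>X\<close> the approximate midpoints of
  \<open>x, x'\<close> contain a ball of a finite codimensional subspace, and the Gorelik principle
  transports this ball to \<open>Y\<close>. Averaging over many scales \<open>\<theta>\<close>, for each \<open>\<tau>\<close> one obtains a gauge
  \<open>P\<close> with \<open>P \<psi> \<ge> P \<phi> + c * \<tau> * (\<psi> - \<phi>) z - C * \<tau> powr q\<close> for \<open>\<psi>\<close> weak-* close to \<open>\<phi>\<close> and all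
  \<open>z\<close> in the unit ball. The geometrically weighted sum of these gauges over \<open>\<tau> = 2 powr - k\<close> is
  dual to the required norm; the weights cost the passage from \<open>q\<close> to a smaller exponent. Weak-*
  compactness of the dual ball provides the finite codimensional subspaces of \<open>Y\<close>.
\<close>

section \<open>Brouwer's theorem on cubes of arbitrary dimension\<close>

text \<open>Asymptotic closeness gives an error \<open>\<epsilon> * R\<close> on the ball of radius
  \<open>K * R\<close> about the origin and no uniform bound on the whole space. So all distances
  and radii are multiples of one \<open>R\<close>, chosen last, and only finitely many scales enter
  the gauge of one \<open>\<tau>\<close>. One midpoint step bounds the slope of
  \<open>\<psi>\<close> at a smaller distance from below by slopes of \<open>\<phi>\<close> at two
  distances. Averaging over \<open>N\<close> scales puts the same gauge on both sides, up to
  boundary terms of order \<open>1 / N\<close>. As the error must be of order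
  \<open>\<tau> powr q\<close>, \<open>N\<close> depends on \<open>\<tau>\<close>; each
  \<open>\<tau>\<close> thus has its own gauge, and only the sum yields one norm. With weights of
  order \<open>2 powr (- e * k)\<close>, level \<open>k\<close> has gain of order
  \<open>2 powr (- (1 + e) * k)\<close> and error of order \<open>2 powr (- (q + e) * k)\<close>;
  this gives the exponent \<open>(q + e) / (1 + e)\<close>, which tends to \<open>q\<close> as
  \<open>e\<close> tends to \<open>0\<close>. The finite set in the Gorelik argument is fixed before
  the displacement, so that one weak-* neighbourhood of \<open>\<phi>\<close> serves all
  \<open>z\<close>.\<close>

definition cube_on :: "nat \<Rightarrow> (nat \<Rightarrow> real) set" where
  "cube_on m = {t. \<forall>i. if i < m then 0 \<le> t i \<and> t i \<le> 1 else t i = 0}"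

lemma compact_cube_on: "compact (cube_on m)"
proof -
  have "cube_on m = PiE UNIV (\<lambda>i. if i < m then {0..1} else {0})"
    by (fastforce simp: cube_on_def PiE_def Pi_def extensional_def split: if_splits)
  moreover have "compactin (product_topology (\<lambda>i::nat. euclidean::real topology) UNIV) (PiE UNIV (\<lambda>i. if i < m then {0..1} else {0}))"
    unfolding compactin_PiE by auto
  ultimately show ?thesis
    by (simp add: euclidean_product_topology)
qed

lemma tendsto_fun_coordinatewise:
  fixes f :: "'a \<Rightarrow> 'i \<Rightarrow> 'b::topological_space"
  assumes "\<And>i. ((\<lambda>x. f x i) \<longlongrightarrow> l i) F"
  shows "(f \<longlongrightarrow> l) F"
proof -
  have "limitin (product_topology (\<lambda>i. euclidean) UNIV) f l F"
    unfolding limitin_componentwise using assms by auto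
  then show ?thesis
    by (simp add: euclidean_product_topology)
qed

lemma tendsto_fun_apply:
  fixes f :: "'a \<Rightarrow> 'i \<Rightarrow> 'b::topological_space"
  assumes "(f \<longlongrightarrow> l) F"
  shows "((\<lambda>x. f x i) \<longlongrightarrow> l i) F"
  using continuous_on_tendsto_compose[OF continuous_on_product_coordinates assms, of i] by simp

text \<open>Kuhn's combinatorial lemma on the grid of mesh \<open>1 / p\<close>: near one cell there
  are, for every coordinate, vertices at which \<open>f\<close> does not decrease and does not
  increase that coordinate. Continuity of \<open>f\<close> enters only when \<open>p\<close>
  grows.\<close>

lemma kuhn_cube_on:
  fixes f :: "(nat \<Rightarrow> real) \<Rightarrow> nat \<Rightarrow> real"
  assumes maps: "f ` cube_on m \<subseteq> cube_on m" and p: "0 < p"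
  obtains t r s where "t \<in> cube_on m"
    "\<And>i. i < m \<Longrightarrow> r i \<in> cube_on m \<and> s i \<in> cube_on m \<and> r i i \<le> f (r i) i \<and> f (s i) i \<le> s i i"
    "\<And>i j. i < m \<Longrightarrow> \<bar>r i j - t j\<bar> \<le> 1 / real p \<and> \<bar>s i j - t j\<bar> \<le> 1 / real p"
proof -
  define pt where "pt x = (\<lambda>i. if i < m then real (x i) / real p else 0)" for x :: "nat \<Rightarrow> nat"
  have pt: "pt x \<in> cube_on m" if "\<forall>i<m. x i \<le> p" for x
    using that p by (auto simp: cube_on_def pt_def)
  \<comment> \<open>Kuhn's lemma prescribes the labels on the faces: 0 where the coordinate
    vanishes, 1 where it is \<open>p\<close>. The inequality read off such a label is still correct
    because \<open>f\<close> maps the cube into itself.\<close>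
  define label :: "(nat \<Rightarrow> nat) \<Rightarrow> nat \<Rightarrow> nat" where
    "label x i = (if x i = 0 \<or> (x i \<noteq> p \<and> pt x i \<le> f (pt x) i) then 0 else 1)" for x i
  have lab0: "pt x i \<le> f (pt x) i" if "\<forall>i<m. x i \<le> p" "i < m" "label x i = 0" for x i
  proof -
    have "f (pt x) \<in> cube_on m" using maps pt[OF that(1)] by auto
    with that show ?thesis by (auto simp: label_def cube_on_def pt_def split: if_splits)
  qed
  have lab1: "f (pt x) i \<le> pt x i" if "\<forall>i<m. x i \<le> p" "i < m" "label x i \<noteq> 0" for x i
  proof -
    have "f (pt x) \<in> cube_on m" using maps pt[OF that(1)] by auto
    with that p show ?thesis by (auto simp: label_def cube_on_def pt_def split: if_splits)
  qed
  obtain q where q: "\<forall>i<m. q i < p"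
    "\<forall>i<m. \<exists>r s. (\<forall>j<m. q j \<le> r j \<and> r j \<le> q j + 1) \<and> (\<forall>j<m. q j \<le> s j \<and> s j \<le> q j + 1) \<and> label r i \<noteq> label s i"
    by (rule kuhn_lemma[OF p, of m label]) (use p in \<open>auto simp: label_def\<close>)
  have ex: "\<exists>r s. r \<in> cube_on m \<and> s \<in> cube_on m \<and> r i \<le> f r i \<and> f s i \<le> s i \<and>
      (\<forall>j. \<bar>r j - pt q j\<bar> \<le> 1 / real p) \<and> (\<forall>j. \<bar>s j - pt q j\<bar> \<le> 1 / real p)" if i: "i < m" for i
  proof -
    have near: "(\<forall>i<m. r i \<le> p) \<and> (\<forall>j. \<bar>pt r j - pt q j\<bar> \<le> 1 / real p)"
      if r: "\<forall>j<m. q j \<le> r j \<and> r j \<le> q j + 1" for r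
    proof -
      have "\<bar>pt r j - pt q j\<bar> \<le> 1 / real p" for j
      proof (cases "j < m")
        case True
        then have "\<bar>real (r j) - real (q j)\<bar> \<le> 1" using r by (auto simp: abs_le_iff)
        then have "\<bar>real (r j) - real (q j)\<bar> / real p \<le> 1 / real p" by (intro divide_right_mono) auto
        then show ?thesis using True p by (simp add: pt_def flip: diff_divide_distrib)
      qed (simp add: pt_def)
      moreover have "\<forall>i<m. r i \<le> p" using r q(1) by (metis Suc_eq_plus1 Suc_leI order_trans)
      ultimately show ?thesis by blast
    qed
    obtain r s where rs: "\<forall>j<m. q j \<le> r j \<and> r j \<le> q j + 1" "\<forall>j<m. q j \<le> s j \<and> s j \<le> q j + 1"
      "label r i \<noteq> label s i" using q(2) i by blast
    note nr = near[OF rs(1)] and ns = near[OF rs(2)]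
    show ?thesis
    proof (cases "label r i = 0")
      case True
      then have "label s i \<noteq> 0" using rs(3) by auto
      then show ?thesis using nr ns lab0[of r i] lab1[of s i] True i pt[of r] pt[of s] by blast
    next
      case False
      then have "label s i = 0" using rs(3) by (auto simp: label_def split: if_splits)
      then show ?thesis using nr ns lab0[of s i] lab1[of r i] False i pt[of r] pt[of s] by blast
    qed
  qed
  then obtain r s where "\<And>i. i < m \<Longrightarrow> r i \<in> cube_on m \<and> s i \<in> cube_on m \<and> r i i \<le> f (r i) i \<and> f (s i) i \<le> s i i \<and>
      (\<forall>j. \<bar>r i j - pt q j\<bar> \<le> 1 / real p) \<and> (\<forall>j. \<bar>s i j - pt q j\<bar> \<le> 1 / real p)"
    by metis
  moreover have "pt q \<in> cube_on m" using q(1) by (intro pt) (auto intro: less_imp_le)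
  ultimately show thesis using that by blast
qed

text \<open>The cube sits in \<open>nat \<Rightarrow> real\<close>, so its dimension is a number and
  may depend on the size of a net found inside a proof. The grid points converge along a
  subsequence, and in each coordinate the two opposite inequalities pass to the limit.\<close>

lemma brouwer_cube_on:
  assumes cont: "continuous_on (cube_on m) f" and maps: "f ` cube_on m \<subseteq> cube_on m"
  obtains t where "t \<in> cube_on m" "f t = t"
proof -
  have "\<exists>t r s. t \<in> cube_on m \<and>
    (\<forall>i<m. r i \<in> cube_on m \<and> s i \<in> cube_on m \<and> r i i \<le> f (r i) i \<and> f (s i) i \<le> s i i) \<and>
    (\<forall>i<m. \<forall>j. \<bar>r i j - t j\<bar> \<le> 1 / real (Suc p) \<and> \<bar>s i j - t j\<bar> \<le> 1 / real (Suc p))" for p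
    by (rule kuhn_cube_on[OF maps, of "Suc p"]) (simp, blast)
  then obtain t r s where t: "\<And>p. t p \<in> cube_on m"
    and rs: "\<And>p i. i < m \<Longrightarrow> r p i \<in> cube_on m \<and> s p i \<in> cube_on m \<and> r p i i \<le> f (r p i) i \<and> f (s p i) i \<le> s p i i"
    and near: "\<And>p i j. i < m \<Longrightarrow> \<bar>r p i j - t p j\<bar> \<le> 1 / real (Suc p) \<and> \<bar>s p i j - t p j\<bar> \<le> 1 / real (Suc p)"
    by metis
  obtain l h where l: "l \<in> cube_on m" and h: "strict_mono h" and lim: "(t \<circ> h) \<longlonglongrightarrow> l"
    using compact_cube_on[of m] t unfolding compact_def by (metis (no_types, lifting))
  have close: "(\<lambda>p. u (h p)) \<longlonglongrightarrow> l" if u: "\<And>p j. \<bar>u p j - t p j\<bar> \<le> 1 / real (Suc p)" for u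
  proof (rule tendsto_fun_coordinatewise)
    fix j
    have "(\<lambda>p. u p j - t p j) \<longlonglongrightarrow> 0"
      by (rule Lim_null_comparison[OF _ LIMSEQ_Suc[OF lim_1_over_n]]) (use u in simp)
    then have "(\<lambda>p. u (h p) j - t (h p) j) \<longlonglongrightarrow> 0"
      by (rule LIMSEQ_subseq_LIMSEQ[OF _ h, unfolded o_def])
    moreover have "(\<lambda>p. t (h p) j) \<longlonglongrightarrow> l j"
      using tendsto_fun_apply[OF lim] by (simp add: o_def)
    ultimately have "(\<lambda>p. u (h p) j - t (h p) j + t (h p) j) \<longlonglongrightarrow> 0 + l j"
      by (rule tendsto_add)
    then show "(\<lambda>p. u (h p) j) \<longlonglongrightarrow> l j" by simp
  qed
  have img: "(\<lambda>p. f (u p) i) \<longlonglongrightarrow> f l i" if "u \<longlonglongrightarrow> l" "\<And>p. u p \<in> cube_on m" for u i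
    by (rule tendsto_fun_apply, rule continuous_on_tendsto_compose[OF cont that(1) l]) (simp add: that(2))
  have "f l i = l i" for i
  proof (cases "i < m")
    case True
    have r: "(\<lambda>p. r (h p) i) \<longlonglongrightarrow> l" and s: "(\<lambda>p. s (h p) i) \<longlonglongrightarrow> l"
      using close[of "\<lambda>p. r p i"] close[of "\<lambda>p. s p i"] near[OF True] by auto
    have "l i \<le> f l i"
      by (rule LIMSEQ_le[OF tendsto_fun_apply[OF r] img[OF r]]) (use rs True in auto)
    moreover have "f l i \<le> l i"
      by (rule LIMSEQ_le[OF img[OF s] tendsto_fun_apply[OF s]]) (use rs True in auto)
    ultimately show ?thesis by simp
  next
    case False
    moreover have "f l \<in> cube_on m" using l maps by blast
    ultimately show ?thesis using l by (simp add: cube_on_def)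
  qed
  then show thesis using that l by blast
qed

section \<open>Functionals\<close>

text \<open>Functionals are plain functions, so that the product topology of the function type
  induces the weak-* topology on each ball.\<close>

definition dual_ball :: "real \<Rightarrow> ('a::real_normed_vector \<Rightarrow> real) set" where
  "dual_ball D = {\<phi>. linear \<phi> \<and> (\<forall>x. \<bar>\<phi> x\<bar> \<le> D * norm x)}"

text \<open>Banach-Alaoglu: the ball is cut out by the closed linearity conditions from a product of
  compact intervals.\<close>

lemma compact_dual_ball: "compact (dual_ball D :: ('a::real_normed_vector \<Rightarrow> real) set)"
proof -
  have "compactin (product_topology (\<lambda>i::'a. euclidean::real topology) UNIV) (PiE UNIV (\<lambda>x. {- (D * norm x)..D * norm x}))"
    unfolding compactin_PiE by auto
  then have K: "compact (PiE UNIV (\<lambda>x::'a. {- (D * norm x)..D * norm x}))"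
    by (simp add: euclidean_product_topology)
  have "closed {\<phi>::'a \<Rightarrow> real. \<phi> (x + y) = \<phi> x + \<phi> y}" for x y :: 'a
    by (rule closed_Collect_eq[OF continuous_on_product_coordinates
          continuous_on_add[OF continuous_on_product_coordinates continuous_on_product_coordinates]])
  moreover have "closed {\<phi>::'a \<Rightarrow> real. \<phi> (c *\<^sub>R x) = c * \<phi> x}" for c :: real and x :: 'a
    by (rule closed_Collect_eq[OF continuous_on_product_coordinates
          continuous_on_mult_left[OF continuous_on_product_coordinates]])
  ultimately have C: "closed ((\<Inter>x y. {\<phi>. \<phi> (x + y) = \<phi> x + \<phi> y}) \<inter> (\<Inter>c x. {\<phi>::'a \<Rightarrow> real. \<phi> (c *\<^sub>R x) = c * \<phi> x}))"
    by (intro closed_Int closed_INT) auto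
  have "dual_ball D = PiE UNIV (\<lambda>x::'a. {- (D * norm x)..D * norm x}) \<inter>
      ((\<Inter>x y. {\<phi>. \<phi> (x + y) = \<phi> x + \<phi> y}) \<inter> (\<Inter>c x. {\<phi>. \<phi> (c *\<^sub>R x) = c * \<phi> x}))"
    by (auto simp: dual_ball_def linear_iff abs_le_iff PiE_def Pi_def minus_le_iff)
  then show ?thesis using compact_Int_closed[OF K C] by simp
qed

section \<open>Sublinear functionals and the Hahn-Banach theorem\<close>

definition sublinear :: "('a::real_vector \<Rightarrow> real) \<Rightarrow> bool" where
  "sublinear q \<longleftrightarrow> (\<forall>x y. q (x + y) \<le> q x + q y) \<and> (\<forall>c x. 0 \<le> c \<longrightarrow> q (c *\<^sub>R x) = c * q x)"

lemma sublinear_add: "sublinear q \<Longrightarrow> q (x + y) \<le> q x + q y"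
  and sublinear_scale: "sublinear q \<Longrightarrow> 0 \<le> c \<Longrightarrow> q (c *\<^sub>R x) = c * q x"
  by (simp_all add: sublinear_def)

lemma sublinear_0: "sublinear q \<Longrightarrow> q 0 = 0"
  using sublinear_scale[of q 0 0] by simp

lemma sublinear_norm: "sublinear (norm :: 'a::real_normed_vector \<Rightarrow> real)"
  by (auto simp: sublinear_def norm_triangle_ineq)

lemma sublinear_minus: "sublinear q \<Longrightarrow> - q (- x) \<le> q x"
  using sublinear_add[of q x "- x"] sublinear_0[of q] by simp

text \<open>\<open>q'\<close> is the largest sublinear functional below \<open>q\<close> whose value
  at \<open>- y\<close> is at most \<open>- q y\<close>; subadditivity forces the formula, an
  infimum along the ray in direction \<open>y\<close>.\<close>

lemma sublinear_directional:
  assumes q: "sublinear q"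
  obtains q' where "sublinear q'" "\<And>x. q' x \<le> q x" "q' (- y) \<le> - q y"
proof -
  define q' where "q' x = (INF t\<in>{0..}. q (x + t *\<^sub>R y) - t * q y)" for x
  have below: "- q (- x) \<le> q (x + t *\<^sub>R y) - t * q y" if "0 \<le> t" for x t
    using sublinear_add[OF q, of "x + t *\<^sub>R y" "- x"] sublinear_scale[OF q that, of y] by simp
  have bdd: "bdd_below ((\<lambda>t. q (x + t *\<^sub>R y) - t * q y) ` {0..})" for x
    using below by (intro bdd_belowI2[where m = "- q (- x)"]) auto
  have le: "q' x \<le> q (x + t *\<^sub>R y) - t * q y" if "0 \<le> t" for x t
    unfolding q'_def using that by (intro cINF_lower bdd) auto
  have "q' (x + z) \<le> q' x + q' z" for x z
  proof -
    have "q' (x + z) - (q (z + s *\<^sub>R y) - s * q y) \<le> q (x + t *\<^sub>R y) - t * q y"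
      if "0 \<le> s" "0 \<le> t" for s t
    proof -
      have "q' (x + z) \<le> q ((x + z) + (s + t) *\<^sub>R y) - (s + t) * q y"
        using that by (intro le) auto
      also have "q ((x + z) + (s + t) *\<^sub>R y) \<le> q (x + t *\<^sub>R y) + q (z + s *\<^sub>R y)"
        using sublinear_add[OF q, of "x + t *\<^sub>R y" "z + s *\<^sub>R y"] by (simp add: algebra_simps)
      finally show ?thesis by (simp add: algebra_simps)
    qed
    then have "q' (x + z) - (q (z + s *\<^sub>R y) - s * q y) \<le> q' x" if "0 \<le> s" for s
      using that unfolding q'_def[of x] by (intro cINF_greatest) auto
    then have "q' (x + z) - q' x \<le> q (z + s *\<^sub>R y) - s * q y" if "0 \<le> s" for s
      using that by (smt (verit))
    then have "q' (x + z) - q' x \<le> q' z"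
      unfolding q'_def[of z] by (intro cINF_greatest) auto
    then show ?thesis by simp
  qed
  moreover have "q' (c *\<^sub>R x) = c * q' x" if c: "0 \<le> c" for c x
  proof (cases "c = 0")
    case True
    have "q' 0 = (INF t\<in>{0::real..}. 0)"
      unfolding q'_def by (rule INF_cong) (simp_all add: sublinear_scale[OF q])
    then have "q' 0 = 0" by simp
    then show ?thesis using True by simp
  next
    case False
    with c have c: "0 < c" by simp
    have sc: "c * q' x \<le> q' (c *\<^sub>R x)" if c: "0 < c" for c x
      unfolding q'_def[of "c *\<^sub>R x"]
    proof (rule cINF_greatest)
      fix t :: real assume t: "t \<in> {0..}"
      have "c * q' x \<le> c * (q (x + (t / c) *\<^sub>R y) - t / c * q y)"
        using c t by (intro mult_left_mono le) auto
      also have "\<dots> = q (c *\<^sub>R (x + (t / c) *\<^sub>R y)) - t * q y"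
        using c sublinear_scale[OF q, of c] by (simp add: right_diff_distrib)
      finally show "c * q' x \<le> q (c *\<^sub>R x + t *\<^sub>R y) - t * q y"
        using c by (simp add: scaleR_add_right)
    qed simp
    have "inverse c * q' (c *\<^sub>R x) \<le> q' x"
      using sc[of "inverse c" "c *\<^sub>R x"] c by simp
    then have "q' (c *\<^sub>R x) \<le> c * q' x"
      using c by (simp add: field_simps)
    with sc[OF c] show ?thesis by (intro antisym) auto
  qed
  ultimately have "sublinear q'" by (auto simp: sublinear_def)
  moreover have "q' x \<le> q x" for x using le[of 0 x] by simp
  moreover have "q' (- y) \<le> - q y" using le[of 1 "- y"] sublinear_0[OF q] by simp
  ultimately show thesis by (rule that)
qed

text \<open>
  A minimal sublinear functional below \<open>p\<close> is linear: minimality forces it to agree with the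
  smaller functional of \<open>sublinear_directional\<close>, whence it is odd.
\<close>

lemma sublinear_dominates_linear:
  assumes p: "sublinear p"
  obtains \<phi> where "linear \<phi>" "\<And>x. \<phi> x \<le> p x"
proof -
  define A where "A = {q. sublinear q \<and> (\<forall>x. q x \<le> p x)}"
  \<comment> \<open>The order is reversed: an upper bound of a chain is a pointwise infimum, and a
    maximal element is a minimal sublinear functional.\<close>
  define P where "P q q' \<longleftrightarrow> (\<forall>x. q' x \<le> q x)" for q q' :: "'a \<Rightarrow> real"
  have "\<exists>m\<in>A. \<forall>q\<in>A. P m q \<longrightarrow> q = m"
  proof (rule predicate_Zorn)
    show "partial_order_on A (relation_of P A)"
      unfolding partial_order_on_def preorder_on_def refl_on_def trans_def antisym_def relation_of_def P_def
      by (auto intro: order_trans intro!: ext[of x y for x y :: "'a \<Rightarrow> real"] antisym)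
    fix C assume C: "C \<in> Chains (relation_of P A)"
    then have CA: "q \<in> A" if "q \<in> C" for q
      using that unfolding Chains_def relation_of_def by auto
    have tot: "P q r \<or> P r q" if "q \<in> C" "r \<in> C" for q r
      using C that unfolding Chains_def relation_of_def by auto
    show "\<exists>u\<in>A. \<forall>a\<in>C. P a u"
    proof (cases "C = {}")
      case True
      then show ?thesis using p by (auto simp: A_def)
    next
      case ne: False
      define u where "u x = (INF q\<in>C. q x)" for x
      have lb: "- p (- x) \<le> q x" if "q \<in> C" for q x
        using sublinear_minus[of q x] CA[OF that] unfolding A_def
        by (smt (verit) mem_Collect_eq)
      have le: "u x \<le> q x" if "q \<in> C" for q x
        unfolding u_def using that lb by (intro cINF_lower bdd_belowI2[where m = "- p (- x)"]) auto
      have "u (x + y) \<le> u x + u y" for x y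
      proof -
        have "u (x + y) - r y \<le> q x" if q: "q \<in> C" and r: "r \<in> C" for q r
        proof -
          \<comment> \<open>Two members of the chain are comparable, so the smaller one serves at
            both \<open>x\<close> and \<open>y\<close>; this makes the infimum subadditive.\<close>
          obtain w where w: "w \<in> C" "w x \<le> q x" "w y \<le> r y"
            using tot[OF q r] q r unfolding P_def by auto
          have "u (x + y) \<le> w (x + y)" by (rule le[OF w(1)])
          also have "\<dots> \<le> w x + w y" using CA[OF w(1)] by (simp add: A_def sublinear_add)
          finally show ?thesis using w by simp
        qed
        then have "u (x + y) - r y \<le> u x" if "r \<in> C" for r
          using that ne unfolding u_def[of x] by (intro cINF_greatest) auto
        then have "u (x + y) - u x \<le> r y" if "r \<in> C" for r
          using that by (smt (verit))
        then have "u (x + y) - u x \<le> u y"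
          using ne unfolding u_def[of y] by (intro cINF_greatest) auto
        then show ?thesis by simp
      qed
      moreover have "u (c *\<^sub>R x) = c * u x" if c: "0 \<le> c" for c x
      proof (cases "c = 0")
        case True
        have "u 0 = (INF q\<in>C. 0)"
          unfolding u_def by (rule INF_cong) (use CA in \<open>auto simp: A_def sublinear_0\<close>)
        then show ?thesis using True ne by simp
      next
        case False
        with c have c: "0 < c" by simp
        have sc: "c * u x \<le> u (c *\<^sub>R x)" if c: "0 < c" for c x
          unfolding u_def[of "c *\<^sub>R x"]
        proof (rule cINF_greatest[OF ne])
          fix q assume q: "q \<in> C"
          have "c * u x \<le> c * q x" using c le[OF q] by simp
          also have "\<dots> = q (c *\<^sub>R x)" using CA[OF q] c by (simp add: A_def sublinear_scale)
          finally show "c * u x \<le> q (c *\<^sub>R x)" .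
        qed
        have "inverse c * u (c *\<^sub>R x) \<le> u x"
          using sc[of "inverse c" "c *\<^sub>R x"] c by simp
        then have "u (c *\<^sub>R x) \<le> c * u x"
          using c by (simp add: field_simps)
        with sc[OF c] show ?thesis by (intro antisym) auto
      qed
      moreover have "u x \<le> p x" for x
      proof -
        obtain q where q: "q \<in> C" using ne by blast
        then have "q x \<le> p x" using CA by (auto simp: A_def)
        with le[OF q, of x] show ?thesis by linarith
      qed
      ultimately have "u \<in> A" by (auto simp: A_def sublinear_def)
      then show ?thesis using le by (auto simp: P_def)
    qed
  qed
  then obtain m where m: "m \<in> A" and min: "\<And>q. q \<in> A \<Longrightarrow> (\<forall>x. q x \<le> m x) \<Longrightarrow> q = m"
    by (auto simp: P_def)
  have sm: "sublinear m" using m by (simp add: A_def)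
  have neg: "m (- y) = - m y" for y
  proof -
    obtain q' where q': "sublinear q'" "\<And>x. q' x \<le> m x" "q' (- y) \<le> - m y"
      using sublinear_directional[OF sm] by blast
    have "q' \<in> A"
      using m q'(1,2) by (auto simp: A_def intro: order_trans)
    then have "q' = m" using min q'(2) by blast
    then show ?thesis using q'(3) sublinear_minus[OF sm, of "- y"] by simp
  qed
  have add: "m (x + y) = m x + m y" for x y
    using sublinear_add[OF sm, of x y] sublinear_add[OF sm, of "- x" "- y"] neg[of x] neg[of y] neg[of "x + y"]
    by simp
  have "m (c *\<^sub>R x) = c * m x" for c x
  proof (cases "0 \<le> c")
    case False
    then have "m (c *\<^sub>R x) = - m ((- c) *\<^sub>R x)"
      using neg[of "c *\<^sub>R x"] by simp
    then show ?thesis using False sublinear_scale[OF sm, of "- c" x] by simp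
  qed (use sublinear_scale[OF sm] in auto)
  then have "linear m" using add by (intro linearI) auto
  moreover have "m x \<le> p x" for x using m by (auto simp: A_def)
  ultimately show thesis by (rule that)
qed

text \<open>Hahn-Banach is applied not to the norm but to its reduction in direction
  \<open>y\<close>, whose value at \<open>- y\<close> forces equality at \<open>y\<close>.\<close>

lemma norming_functional:
  fixes y :: "'a::real_normed_vector"
  obtains \<phi> where "\<phi> \<in> dual_ball 1" "\<phi> y = norm y"
proof -
  obtain q where q: "sublinear q" "\<And>x. q x \<le> norm x" "q (- y) \<le> - norm y"
    using sublinear_directional[OF sublinear_norm] by blast
  obtain \<phi> where \<phi>: "linear \<phi>" "\<And>x. \<phi> x \<le> q x"
    using sublinear_dominates_linear[OF q(1)] by blast
  have le: "\<phi> x \<le> norm x" for x using \<phi>(2)[of x] q(2)[of x] by linarith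
  have "\<phi> (- x) = - \<phi> x" for x by (rule linear_neg[OF \<phi>(1)])
  then have "\<bar>\<phi> x\<bar> \<le> norm x" for x using le[of x] le[of "- x"] by simp
  moreover have "norm y \<le> \<phi> y" using \<phi>(2)[of "- y"] q(3) linear_neg[OF \<phi>(1), of y] by linarith
  ultimately show thesis using that[of \<phi>] \<phi>(1) le[of y] by (simp add: dual_ball_def)
qed

section \<open>The Gorelik principle\<close>

text \<open>The distance from \<open>v\<close> to \<open>E\<close> controls the coefficient of
  \<open>v\<close>. So the coefficients along a convergent sequence are Cauchy, and the limit stays
  in the sum.\<close>

lemma closed_add_line:
  fixes E :: "'a::real_normed_vector set"
  assumes E: "subspace E" "closed E" and v: "v \<notin> E"
  shows "infdist v E > 0" "\<And>e c. e \<in> E \<Longrightarrow> \<bar>c\<bar> * infdist v E \<le> norm (e + c *\<^sub>R v)"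
    "closed (span (insert v E))"
proof -
  have ne: "E \<noteq> {}" using subspace_0[OF E(1)] by blast
  show pos: "infdist v E > 0"
    by (rule infdist_pos_not_in_closed[OF E(2) ne v])
  show bd: "\<bar>c\<bar> * infdist v E \<le> norm (e + c *\<^sub>R v)" if e: "e \<in> E" for e c
  proof (cases "c = 0")
    case False
    have "- (1 / c) *\<^sub>R e \<in> E" using e E(1) by (rule subspace_scale[rotated])
    then have "infdist v E \<le> dist v (- (1 / c) *\<^sub>R e)" by (rule infdist_le)
    also have "\<dots> = norm ((1 / c) *\<^sub>R (e + c *\<^sub>R v))"
      using False by (simp add: dist_norm algebra_simps)
    also have "\<dots> = norm (e + c *\<^sub>R v) / \<bar>c\<bar>" by simp
    finally show ?thesis using False by (simp add: field_simps)
  qed simp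
  show "closed (span (insert v E))"
    unfolding closed_sequential_limits
  proof (intro allI impI, elim conjE)
    fix x l assume x: "\<forall>n. x n \<in> span (insert v E)" and lim: "x \<longlonglongrightarrow> l"
    have "\<exists>c. x n - c *\<^sub>R v \<in> E" for n
      using x E(1) by (metis span_breakdown_eq span_eq_iff)
    then obtain c where c: "\<And>n. x n - c n *\<^sub>R v \<in> E" by metis
    have diff: "\<bar>c m - c n\<bar> * infdist v E \<le> norm (x m - x n)" for m n
      using bd[OF subspace_diff[OF E(1) c[of m] c[of n]], of "c m - c n"] by (simp add: algebra_simps)
    have "Cauchy c"
    proof (rule metric_CauchyI)
      fix e :: real assume "0 < e"
      then have "0 < e * infdist v E" using pos by simp
      then obtain M where M: "\<And>m n. m \<ge> M \<Longrightarrow> n \<ge> M \<Longrightarrow> dist (x m) (x n) < e * infdist v E"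
        using LIMSEQ_imp_Cauchy[OF lim] unfolding Cauchy_def by blast
      have "dist (c m) (c n) < e" if "m \<ge> M" "n \<ge> M" for m n
      proof -
        have "\<bar>c m - c n\<bar> * infdist v E < e * infdist v E"
          using diff[of m n] M[OF that] by (simp add: dist_norm)
        then show ?thesis using pos by (simp add: dist_norm)
      qed
      then show "\<exists>M. \<forall>m\<ge>M. \<forall>n\<ge>M. dist (c m) (c n) < e" by blast
    qed
    then obtain c0 where c0: "c \<longlonglongrightarrow> c0" by (auto simp: Cauchy_convergent_iff convergent_def)
    have "(\<lambda>n. x n - c n *\<^sub>R v) \<longlonglongrightarrow> l - c0 *\<^sub>R v"
      by (intro tendsto_diff tendsto_scaleR lim c0 tendsto_const)
    then have "l - c0 *\<^sub>R v \<in> E"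
      by (rule closed_sequentially[OF E(2), rotated]) (rule c)
    then show "l \<in> span (insert v E)"
      by (metis span_breakdown_eq span_superset subsetD)
  qed
qed

text \<open>Induction on the complementary vectors with \<open>E\<close> arbitrary: \<open>v\<close>
  is absorbed into the subspace, and a net modulo the larger subspace is refined by discretising the
  coefficient of \<open>v\<close>, which is bounded because \<open>v\<close> has positive distance
  to \<open>E\<close>.\<close>

lemma totally_bounded_mod_aux:
  fixes E :: "'a::real_normed_vector set"
  assumes "finite V" "subspace E" "closed E" "span (E \<union> V) = UNIV" "0 < \<eta>"
  shows "\<exists>S. finite S \<and> (\<forall>x. norm x \<le> d \<longrightarrow> (\<exists>s\<in>S. \<exists>e\<in>E. norm (x - s - e) < \<eta>))"
  using assms
proof (induction V arbitrary: E \<eta> rule: finite_induct)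
  case empty
  then have "E = UNIV" by (metis Un_empty_right span_eq_iff)
  then have "\<exists>s\<in>{0}. \<exists>e\<in>E. norm (x - s - e) < \<eta>" for x
    using \<open>0 < \<eta>\<close> by (intro bexI[of _ 0] bexI[of _ x]) auto
  then show ?case by blast
next
  case (insert v V)
  show ?case
  proof (cases "v \<in> E")
    case True
    then have "E \<union> insert v V = E \<union> V" by blast
    then show ?thesis using insert by metis
  next
    case v: False
    note line = closed_add_line[OF insert.prems(1,2) v]
    define \<delta> where "\<delta> = infdist v E"
    let ?E = "span (insert v E)"
    have "E \<union> insert v V \<subseteq> ?E \<union> V"
      using span_superset[of "insert v E"] by blast
    then have "span (E \<union> insert v V) \<subseteq> span (?E \<union> V)" by (rule span_mono)
    then have "span (?E \<union> V) = UNIV" using insert.prems by blast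
    then obtain S where S: "finite S" "\<And>x. norm x \<le> d \<Longrightarrow> \<exists>s\<in>S. \<exists>e\<in>?E. norm (x - s - e) < \<eta> / 2"
      using insert.IH[of ?E "\<eta> / 2"] line(3) insert.prems(4) by auto
    define B where "B = d + (\<Sum>s\<in>S. norm s) + \<eta>"
    have "compact {- (B / \<delta>)..B / \<delta>}" by simp
    moreover have "0 < \<eta> / (2 * (norm v + 1))" using insert.prems(4) by (intro divide_pos_pos mult_pos_pos add_nonneg_pos) auto
    ultimately obtain K where K: "finite K" "{- (B / \<delta>)..B / \<delta>} \<subseteq> (\<Union>c\<in>K. ball c (\<eta> / (2 * (norm v + 1))))"
      unfolding compact_eq_totally_bounded by meson
    show ?thesis
    proof (intro exI[of _ "(\<lambda>(s, c). s + c *\<^sub>R v) ` (S \<times> K)"] conjI allI impI)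
      fix x :: 'a assume x: "norm x \<le> d"
      obtain s w where s: "s \<in> S" and w: "w \<in> ?E" "norm (x - s - w) < \<eta> / 2"
        using S(2)[OF x] by blast
      obtain c where c: "w - c *\<^sub>R v \<in> E"
        using w(1) insert.prems(1) by (metis span_breakdown_eq span_eq_iff)
      have "\<bar>c\<bar> * \<delta> \<le> norm w" using line(2)[OF c, of c] by (simp add: \<delta>_def)
      also have "\<dots> \<le> norm x + norm s + norm (x - s - w)"
        using norm_triangle_ineq4[of "x - s" "x - s - w"] norm_triangle_ineq4[of x s] by simp
      also have "\<dots> \<le> B"
        using x w(2) member_le_sum[OF s _ S(1), of norm] insert.prems(4) unfolding B_def by simp
      finally have "\<bar>c\<bar> \<le> B / \<delta>" using line(1) by (simp add: \<delta>_def field_simps)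
      then have "c \<in> {- (B / \<delta>)..B / \<delta>}" by (auto simp: abs_le_iff)
      then obtain c' where "c' \<in> K" "c \<in> ball c' (\<eta> / (2 * (norm v + 1)))"
        using K(2) by blast
      then have c': "c' \<in> K" "\<bar>c' - c\<bar> < \<eta> / (2 * (norm v + 1))"
        by (simp_all only: mem_ball dist_real_def)
      have nv: "0 < norm v + 1" by (simp add: add_nonneg_pos)
      have "norm ((c - c') *\<^sub>R v) \<le> \<bar>c' - c\<bar> * (norm v + 1)"
        by (simp add: abs_minus_commute mult_left_mono)
      also have "\<dots> < \<eta> / 2" using c'(2) nv by (simp add: field_simps)
      finally have "norm ((x - s - w) + (c - c') *\<^sub>R v) < \<eta>"
        using w(2) norm_triangle_ineq[of "x - s - w" "(c - c') *\<^sub>R v"] by linarith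
      then have "norm (x - (s + c' *\<^sub>R v) - (w - c *\<^sub>R v)) < \<eta>"
        by (simp add: algebra_simps)
      with c c' s show "\<exists>s\<in>(\<lambda>(s, c). s + c *\<^sub>R v) ` (S \<times> K). \<exists>e\<in>E. norm (x - s - e) < \<eta>"
        by force
    qed (use S(1) K(1) in simp)
  qed
qed

text \<open>The net is moved into the ball of radius \<open>d\<close>: each useful net point is
  replaced by a point of the ball near it modulo \<open>E\<close>, at the cost of half of
  \<open>\<eta>\<close>. Convex combinations of the net then stay in the ball.\<close>

lemma totally_bounded_mod:
  fixes E :: "'a::real_normed_vector set"
  assumes E: "E \<in> cof" and \<eta>: "0 < \<eta>"
  obtains S where "finite S" "\<And>s. s \<in> S \<Longrightarrow> norm s \<le> d"
    "\<And>x. norm x \<le> d \<Longrightarrow> \<exists>s\<in>S. infdist (x - s) E < \<eta>"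
proof -
  obtain F where sE: "subspace E" and F: "closed E" "finite F" "span (E \<union> F) = UNIV"
    using E by (auto simp: cof_def)
  have "0 < \<eta> / 2" using \<eta> by simp
  from totally_bounded_mod_aux[OF F(2) sE F(1,3) this, of d]
  obtain S where S: "finite S" "\<And>x. norm x \<le> d \<Longrightarrow> \<exists>s\<in>S. \<exists>e\<in>E. norm (x - s - e) < \<eta> / 2"
    by blast
  define near where "near s x \<longleftrightarrow> norm x \<le> d \<and> (\<exists>e\<in>E. norm (x - s - e) < \<eta> / 2)" for s x :: 'a
  define S' where "S' = (\<lambda>s. SOME x. near s x) ` {s \<in> S. \<exists>x. near s x}"
  have some: "near s (SOME x. near s x)" if "near s x" for s x
    by (rule someI[of "near s", OF that])
  show thesis
  proof (rule that[of S'])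
    show "finite S'" using S(1) by (simp add: S'_def)
    show "norm s \<le> d" if "s \<in> S'" for s
      using that some by (auto simp: S'_def near_def)
    show "\<exists>s\<in>S'. infdist (x - s) E < \<eta>" if x: "norm x \<le> d" for x
    proof -
      obtain s where s: "s \<in> S" "near s x" using S(2)[OF x] x by (auto simp: near_def)
      define y where "y = (SOME x. near s x)"
      have y: "near s y" unfolding y_def by (rule some[OF s(2)])
      obtain e e' where e: "e \<in> E" "norm (x - s - e) < \<eta> / 2" and e': "e' \<in> E" "norm (y - s - e') < \<eta> / 2"
        using s(2) y by (auto simp: near_def)
      have "infdist (x - y) E \<le> dist (x - y) (e - e')"
        by (intro infdist_le subspace_diff[OF sE] e e')
      also have "\<dots> = norm ((x - s - e) - (y - s - e'))" by (simp add: dist_norm algebra_simps)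
      also have "\<dots> < \<eta>" using norm_triangle_ineq4[of "x - s - e" "y - s - e'"] e e' by linarith
      finally show ?thesis using s y_def by (auto simp: S'_def)
    qed
  qed
qed

lemma norm_weighted_mean_le:
  fixes v :: "'i \<Rightarrow> 'a::real_normed_vector"
  assumes c: "\<And>i. i \<in> I \<Longrightarrow> 0 \<le> c i" and pos: "0 < sum c I"
    and near: "\<And>i. i \<in> I \<Longrightarrow> 0 < c i \<Longrightarrow> norm (v i - u) \<le> B"
  shows "norm ((\<Sum>i\<in>I. c i *\<^sub>R v i) /\<^sub>R sum c I - u) \<le> B"
proof -
  have "(\<Sum>i\<in>I. c i *\<^sub>R v i) /\<^sub>R sum c I - u = (\<Sum>i\<in>I. c i *\<^sub>R (v i - u)) /\<^sub>R sum c I"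
    using pos by (simp add: scaleR_diff_right sum_subtractf flip: scaleR_left.sum)
  also have "norm \<dots> \<le> (\<Sum>i\<in>I. norm (c i *\<^sub>R (v i - u))) / sum c I"
    using pos norm_sum[of "\<lambda>i. c i *\<^sub>R (v i - u)" I] by (simp add: divide_simps mult.commute)
  also have "\<dots> \<le> (\<Sum>i\<in>I. c i * B) / sum c I"
  proof (intro divide_right_mono sum_mono)
    fix i assume i: "i \<in> I"
    show "norm (c i *\<^sub>R (v i - u)) \<le> c i * B"
    proof (cases "c i = 0")
      case False
      then show ?thesis using c[OF i] near[OF i] by (simp add: mult_left_mono)
    qed simp
  qed (use pos in simp)
  also have "\<dots> = B" using pos by (simp flip: sum_distrib_right)
  finally show ?thesis .
qed

lemma infdist_less_imp:
  assumes "infdist x A < r" "A \<noteq> {}"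
  obtains a where "a \<in> A" "dist x a < r"
proof -
  have "\<exists>a\<in>A. dist x a < r"
  proof (rule ccontr)
    assume "\<not> ?thesis"
    then have "r \<le> (INF a\<in>A. dist x a)"
      using assms(2) by (intro cINF_greatest) (auto simp: not_less)
    with assms show False by (simp add: infdist_notempty)
  qed
  with that show thesis by blast
qed

text \<open>
  The topological core of the Gorelik principle. No continuity of \<open>\<Phi>\<close> is assumed: the values
  of \<open>\<Phi>\<close> on the finite set \<open>A\<close> are interpolated by a partition of unity, and \<open>\<kappa>\<close> pays for the
  oscillation of \<open>\<Phi>\<close> at scale \<open>\<theta>\<close>. Brouwer's theorem is applied on the cube of coefficients of a
  finite net of a ball modulo \<open>E\<close>.
\<close>

lemma finite_codim_meets_perturbation:
  fixes E :: "'a::real_normed_vector set"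
  assumes E: "E \<in> cof" and d: "0 \<le> d" and \<theta>: "0 < \<theta>" and \<eta>: "0 < \<eta>"
  obtains A where "finite A" "\<And>a. a \<in> A \<Longrightarrow> norm a \<le> d"
    "\<And>\<Phi> \<kappa>. (\<And>a. a \<in> A \<Longrightarrow> norm (\<Phi> a - a) \<le> d) \<Longrightarrow>
      (\<And>a a'. a \<in> A \<Longrightarrow> a' \<in> A \<Longrightarrow> norm (a - a') < \<theta> \<Longrightarrow> norm (\<Phi> a - \<Phi> a') \<le> \<kappa>) \<Longrightarrow>
      \<exists>a\<in>A. \<exists>e\<in>E. norm (e - \<Phi> a) \<le> \<kappa> + \<eta>"
proof -
  have sE: "subspace E" using E by (simp add: cof_def)
  then have Ene: "E \<noteq> {}" using subspace_0 by blast
  define \<epsilon> where "\<epsilon> = \<eta> / 2"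
  have \<epsilon>: "0 < \<epsilon>" using \<eta> by (simp add: \<epsilon>_def)
  obtain S where S: "finite S" "\<And>s. s \<in> S \<Longrightarrow> norm s \<le> d"
    "\<And>x. norm x \<le> d \<Longrightarrow> \<exists>s\<in>S. infdist (x - s) E < \<epsilon>"
    using totally_bounded_mod[OF E \<epsilon>] by metis
  obtain m s where Ss: "S = s ` {i::nat. i < m}"
    using finite_imp_nat_seg_image_inj_on[OF S(1)] by blast
  have sd: "norm (s i) \<le> d" if "i < m" for i using S(2) Ss that by blast
  \<comment> \<open>The maximum with \<open>1\<close> keeps \<open>pt\<close> continuous on the
    whole cube, including the origin. At the fixed point the coefficients sum to \<open>1\<close>,
    and \<open>pt\<close> is a convex combination.\<close>
  define pt where "pt t = (\<Sum>i<m. t i *\<^sub>R s i) /\<^sub>R max 1 (\<Sum>i<m. t i)" for t :: "nat \<Rightarrow> real"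
  have coord: "continuous_on X (\<lambda>t. t i :: real)" for X and i :: nat
    by (rule continuous_on_subset[OF continuous_on_product_coordinates]) simp
  have cont_pt: "continuous_on (cube_on m) pt"
    unfolding pt_def by (intro continuous_intros coord) auto
  have pt_norm: "norm (pt t) \<le> d" if t: "t \<in> cube_on m" for t
  proof -
    have "norm (\<Sum>i<m. t i *\<^sub>R s i) \<le> (\<Sum>i<m. t i * d)"
      using t sd by (intro sum_norm_le) (auto simp: cube_on_def mult_left_mono split: if_splits)
    also have "\<dots> \<le> max 1 (\<Sum>i<m. t i) * d"
      using d by (simp add: mult_right_mono flip: sum_distrib_right)
    finally show ?thesis by (simp add: pt_def field_simps)
  qed
  define K where "K = pt ` cube_on m"
  have "compact K" unfolding K_def by (rule compact_continuous_image[OF cont_pt compact_cube_on])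
  define r where "r = min (\<theta> / 2) \<epsilon>"
  have r: "0 < r" "r \<le> \<epsilon>" "2 * r \<le> \<theta>" using \<theta> \<epsilon> by (auto simp: r_def)
  obtain A where A: "finite A" "A \<subseteq> K" "K \<subseteq> (\<Union>x\<in>A. ball x r)"
    using seq_compact_imp_totally_bounded[of K] \<open>compact K\<close> r(1) by (meson compact_imp_seq_compact)
  show thesis
  proof (rule that[OF A(1)])
    show "norm a \<le> d" if "a \<in> A" for a using that A(2) pt_norm by (auto simp: K_def)
    fix \<Phi> :: "'a \<Rightarrow> 'a" and \<kappa> :: real
    assume move: "\<And>a. a \<in> A \<Longrightarrow> norm (\<Phi> a - a) \<le> d"
      and osc: "\<And>a a'. a \<in> A \<Longrightarrow> a' \<in> A \<Longrightarrow> norm (a - a') < \<theta> \<Longrightarrow> norm (\<Phi> a - \<Phi> a') \<le> \<kappa>"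
    define w where "w x a = max 0 (r - dist x a)" for x a :: 'a
    have w0: "0 \<le> w x a" for x a by (simp add: w_def)
    have wpos: "dist x a < r" if "0 < w x a" for x a using that by (simp add: w_def split: if_splits)
    define mean where "mean x f = (\<Sum>a\<in>A. w x a *\<^sub>R f a) /\<^sub>R sum (w x) A" for x and f :: "'a \<Rightarrow> 'a"
    have Wpos: "0 < sum (w x) A" if x: "x \<in> K" for x
    proof -
      obtain a where "a \<in> A" "dist x a < r" using x A(3) by (auto simp: dist_commute)
      then show ?thesis by (intro sum_pos2[OF A(1)]) (auto simp: w_def)
    qed
    have cont_mean: "continuous_on K (\<lambda>x. mean x f)" for f
      unfolding mean_def by (intro continuous_intros) (use Wpos in \<open>force simp: w_def intro!: continuous_intros\<close>)+
    \<comment> \<open>\<open>T\<close> interpolates the identity minus \<open>\<Phi>\<close>. If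
      \<open>T x\<close> is close to \<open>x\<close> modulo \<open>E\<close>, then the interpolated
      value of \<open>\<Phi>\<close> at \<open>x\<close> is close to \<open>E\<close>.\<close>
    define T where "T x = mean x (\<lambda>a. a - \<Phi> a)" for x
    have T_norm: "norm (T x) \<le> d" if "x \<in> K" for x
      using norm_weighted_mean_le[of A "w x" "\<lambda>a. a - \<Phi> a" 0 d] w0 Wpos[OF that] move
      by (simp add: T_def mean_def norm_minus_commute)
    \<comment> \<open>These weights single out the net points close to \<open>T x\<close> modulo
      \<open>E\<close>. A fixed point of the normalised weights gives a convex combination
      \<open>x\<close> of such points, so \<open>x\<close> itself is close to \<open>T x\<close>
      modulo \<open>E\<close>.\<close>
    define \<mu> where "\<mu> x i = max 0 (\<epsilon> - infdist (T x - s i) E)" for x i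
    have \<mu>0: "0 \<le> \<mu> x i" for x i by (simp add: \<mu>_def)
    have Mpos: "0 < (\<Sum>i<m. \<mu> x i)" if x: "x \<in> K" for x
    proof -
      obtain i where "i < m" "infdist (T x - s i) E < \<epsilon>"
        using S(3)[OF T_norm[OF x]] Ss by auto
      then show ?thesis by (intro sum_pos2[of _ i]) (auto simp: \<mu>_def)
    qed
    define f where "f t i = (if i < m then \<mu> (pt t) i / (\<Sum>i<m. \<mu> (pt t) i) else 0)" for t i
    have cont_T: "continuous_on (cube_on m) (\<lambda>t. T (pt t))"
      using continuous_on_compose2[OF cont_mean cont_pt] by (auto simp: T_def K_def)
    have "continuous_on (cube_on m) (\<lambda>t. f t i)" for i
    proof (cases "i < m")
      case True
      have "continuous_on (cube_on m) (\<lambda>t. \<mu> (pt t) j)" for j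
        unfolding \<mu>_def by (intro continuous_intros cont_T)
      moreover have "(\<Sum>i<m. \<mu> (pt t) i) \<noteq> 0" if "t \<in> cube_on m" for t
        using Mpos[of "pt t"] that by (auto simp: K_def)
      ultimately show ?thesis using True by (simp add: f_def continuous_on_divide continuous_on_sum)
    qed (simp add: f_def)
    then have "continuous_on (cube_on m) f" by (rule continuous_on_coordinatewise_then_product)
    moreover have "f ` cube_on m \<subseteq> cube_on m"
    proof -
      have "\<mu> (pt t) i / (\<Sum>i<m. \<mu> (pt t) i) \<le> 1" if "t \<in> cube_on m" "i < m" for t i
        using Mpos[of "pt t"] that member_le_sum[of i "{..<m}" "\<mu> (pt t)"] \<mu>0 by (auto simp: K_def)
      then show ?thesis by (auto simp: cube_on_def f_def \<mu>0 sum_nonneg)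
    qed
    ultimately obtain t where t: "t \<in> cube_on m" "f t = t" by (rule brouwer_cube_on)
    define x where "x = pt t"
    have x: "x \<in> K" using t(1) by (simp add: x_def K_def)
    have ti: "t i = \<mu> x i / (\<Sum>i<m. \<mu> x i)" if "i < m" for i
      using fun_cong[OF t(2), of i] that by (simp add: f_def x_def)
    have sum1: "(\<Sum>i<m. t i) = 1"
      using Mpos[OF x] ti by (simp flip: sum_divide_distrib)
    then have xt: "x = (\<Sum>i<m. t i *\<^sub>R s i)" by (simp add: x_def pt_def)
    have "\<exists>e\<in>E. i < m \<longrightarrow> 0 < t i \<longrightarrow> norm (T x - s i - e) \<le> \<epsilon>" for i
    proof (cases "i < m \<and> 0 < t i")
      case True
      then have "0 < \<mu> x i" using ti[of i] Mpos[OF x] by (simp add: zero_less_divide_iff)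
      then have "infdist (T x - s i) E < \<epsilon>" by (simp add: \<mu>_def split: if_splits)
      then show ?thesis using infdist_less_imp[OF _ Ene] by (metis dist_norm less_imp_le)
    qed (use Ene in auto)
    then obtain e where e: "\<And>i. e i \<in> E" "\<And>i. i < m \<Longrightarrow> 0 < t i \<Longrightarrow> norm (T x - s i - e i) \<le> \<epsilon>"
      by metis
    define e' where "e' = (\<Sum>i<m. t i *\<^sub>R e i)"
    have e': "e' \<in> E" unfolding e'_def by (intro subspace_sum subspace_scale sE e)
    have "norm ((\<Sum>i<m. t i *\<^sub>R (T x - s i - e i)) /\<^sub>R (\<Sum>i<m. t i) - 0) \<le> \<epsilon>"
      by (rule norm_weighted_mean_le) (use t(1) e(2) sum1 in \<open>auto simp: cube_on_def split: if_splits\<close>)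
    then have Tx: "norm (T x - x - e') \<le> \<epsilon>"
      by (simp add: sum1 xt e'_def scaleR_diff_right sum_subtractf flip: scaleR_left.sum)
    have Qx: "norm (mean x (\<lambda>a. a) - x) \<le> \<epsilon>"
      unfolding mean_def
    proof (rule norm_weighted_mean_le)
      fix a assume "0 < w x a"
      from wpos[OF this] r(2) show "norm (a - x) \<le> \<epsilon>"
        by (simp add: dist_norm norm_minus_commute)
    qed (use w0 Wpos[OF x] in auto)
    obtain a0 where a0: "a0 \<in> A" "dist x a0 < r" using x A(3) by (auto simp: dist_commute)
    have "norm (mean x \<Phi> - \<Phi> a0) \<le> \<kappa>"
      unfolding mean_def
    proof (rule norm_weighted_mean_le)
      fix a assume a: "a \<in> A" "0 < w x a"
      have "norm (a - a0) < \<theta>"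
        using dist_triangle[of a a0 x] wpos[OF a(2)] a0(2) r(3) by (simp add: dist_norm norm_minus_commute)
      then show "norm (\<Phi> a - \<Phi> a0) \<le> \<kappa>" by (rule osc[OF a(1) a0(1)])
    qed (use w0 Wpos[OF x] in auto)
    moreover have "T x = mean x (\<lambda>a. a) - mean x \<Phi>"
      by (simp add: T_def mean_def scaleR_diff_right sum_subtractf)
    moreover have "- e' - \<Phi> a0 = (T x - x - e') - (mean x (\<lambda>a. a) - x) + (mean x \<Phi> - \<Phi> a0) + (mean x (\<lambda>a. a) - mean x \<Phi> - T x)"
      by simp
    ultimately have "norm (- e' - \<Phi> a0) \<le> \<epsilon> + \<epsilon> + \<kappa>"
      using norm_triangle_ineq[of "(T x - x - e') - (mean x (\<lambda>a. a) - x)" "mean x \<Phi> - \<Phi> a0"]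
        norm_triangle_ineq4[of "T x - x - e'" "mean x (\<lambda>a. a) - x"] Tx Qx by simp
    then show "\<exists>a\<in>A. \<exists>e\<in>E. norm (e - \<Phi> a) \<le> \<kappa> + \<eta>"
      using a0(1) subspace_neg[OF sE e'] by (intro bexI[of _ a0] bexI[of _ "- e'"]) (auto simp: \<epsilon>_def)
  qed
qed

section \<open>Asymptotic smoothness and asymptotic closeness\<close>

lemma UNIV_in_cof: "UNIV \<in> cof"
  by (auto simp: cof_def intro!: exI[of _ "{}"])

lemma cof_finite_dim: "finite_dim_space TYPE('a::real_normed_vector) \<Longrightarrow> {0 :: 'a} \<in> cof"
proof -
  assume "finite_dim_space TYPE('a)"
  then obtain F :: "'a set" where F: "finite F" "span F = UNIV" by (auto simp: finite_dim_space_def)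
  have "span ({0} \<union> F) = UNIV" using span_mono[of F "{0} \<union> F"] F(2) by auto
  with F show ?thesis by (auto simp: cof_def)
qed

text \<open>The modulus controls vectors of \<open>E\<close> of norm exactly \<open>\<tau>\<close>;
  a shorter one is a convex combination of two opposite vectors of norm \<open>\<tau>\<close>, and
  the norm is convex. In finite dimension \<open>{0}\<close> serves.\<close>

lemma aus_modulus_finite_codim:
  fixes x :: "'a::real_normed_vector"
  assumes s: "aus_modulus (norm :: 'a \<Rightarrow> real) \<tau> < s" "0 \<le> s" and \<tau>: "0 < \<tau>" and x: "norm x = 1"
  shows "\<exists>E\<in>cof. \<forall>e\<in>E. norm e \<le> \<tau> \<longrightarrow> norm (x + e) \<le> 1 + s"
proof (cases "finite_dim_space TYPE('a)")
  case True
  then show ?thesis using cof_finite_dim[OF True] x s(2) by (intro bexI[of _ "{0}"]) auto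
next
  case False
  let ?S = "unit_sphere_on (norm :: 'a \<Rightarrow> real)"
  let ?f = "\<lambda>x Y. SUP y\<in>?S Y. norm (x + \<tau> *\<^sub>R y)"
  have le: "norm (u + \<tau> *\<^sub>R y) \<le> 1 + \<tau>" if "norm u = 1" "y \<in> ?S Y" for u y Y
    using that norm_triangle_ineq[of u "\<tau> *\<^sub>R y"] \<tau> by (simp add: unit_sphere_on_def)
  then have bdd: "bdd_above ((\<lambda>y. norm (u + \<tau> *\<^sub>R y)) ` ?S Y)" if "norm u = 1" for u Y
    using that by (intro bdd_aboveI2[where M = "1 + \<tau>"])
  \<comment> \<open>For an empty sphere the supremum is the unspecified \<open>Sup {}\<close>; with
    it in the lower bound, the infimum over \<open>cof\<close> is bounded below whether or not
    spheres are empty.\<close>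
  have nonneg: "min 0 (Sup {}) \<le> ?f u Y" if u: "norm u = 1" for u Y
  proof (cases "?S Y = {}")
    case False
    then obtain y where y: "y \<in> ?S Y" by blast
    have "0 \<le> norm (u + \<tau> *\<^sub>R y)" by simp
    also have "\<dots> \<le> ?f u Y" by (rule cSUP_upper[OF y bdd[OF u]])
    finally show ?thesis by simp
  qed simp
  have xU: "x \<in> ?S UNIV" using x by (simp add: unit_sphere_on_def)
  have "(INF Y\<in>cof. ?f u Y) \<le> 1 + \<tau>" if u: "u \<in> ?S UNIV" for u
  proof -
    have u1: "norm u = 1" using u by (simp add: unit_sphere_on_def)
    have "(INF Y\<in>cof. ?f u Y) \<le> ?f u UNIV"
      by (intro cINF_lower UNIV_in_cof bdd_belowI2[OF nonneg[OF u1]])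
    also have "\<dots> \<le> 1 + \<tau>" using u le[OF u1] by (intro cSUP_least) auto
    finally show ?thesis .
  qed
  then have "(INF Y\<in>cof. ?f x Y) \<le> (SUP u\<in>?S UNIV. INF Y\<in>cof. ?f u Y)"
    by (intro cSUP_upper xU bdd_aboveI2[where M = "1 + \<tau>"])
  also have "\<dots> < 1 + s" using s(1) False by (simp add: aus_modulus_def)
  finally have "\<not> (1 + s \<le> (INF Y\<in>cof. ?f x Y))" by simp
  then have "\<exists>E\<in>cof. ?f x E < 1 + s"
    by (metis UNIV_in_cof cINF_greatest empty_iff not_le)
  then obtain E where E: "E \<in> cof" "?f x E < 1 + s" by blast
  have sE: "subspace E" using E(1) by (simp add: cof_def)
  have up: "norm (x + \<tau> *\<^sub>R y) \<le> 1 + s" if "y \<in> ?S E" for y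
    using cSUP_upper[OF that bdd[OF x]] E(2) by linarith
  have "norm (x + e) \<le> 1 + s" if e: "e \<in> E" "norm e \<le> \<tau>" for e
  proof (cases "e = 0")
    case e0: False
    define y where "y = (1 / norm e) *\<^sub>R e"
    define c where "c = norm e / \<tau>"
    have c: "0 \<le> c" "c \<le> 1" using e(2) \<tau> by (simp_all add: c_def)
    have y: "y \<in> ?S E" "- y \<in> ?S E"
      using e0 e(1) sE by (auto simp: y_def unit_sphere_on_def subspace_scale subspace_neg)
    have "((1 + c) / 2) *\<^sub>R (x + \<tau> *\<^sub>R y) + ((1 - c) / 2) *\<^sub>R (x + \<tau> *\<^sub>R (- y)) =
        ((1 + c) / 2 + (1 - c) / 2) *\<^sub>R x + ((1 + c) / 2 * \<tau> - (1 - c) / 2 * \<tau>) *\<^sub>R y"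
      by (simp only: scaleR_add_right scaleR_add_left scaleR_diff_left scaleR_minus_right scaleR_scaleR) simp
    also have "(1 + c) / 2 + (1 - c) / 2 = 1" by (simp add: field_simps)
    also have "(1 + c) / 2 * \<tau> - (1 - c) / 2 * \<tau> = c * \<tau>" by (simp add: field_simps)
    also have "(c * \<tau>) *\<^sub>R y = e" using e0 \<tau> by (simp add: y_def c_def)
    finally have "x + e = ((1 + c) / 2) *\<^sub>R (x + \<tau> *\<^sub>R y) + ((1 - c) / 2) *\<^sub>R (x + \<tau> *\<^sub>R (- y))"
      by simp
    then have "norm (x + e) \<le> (1 + c) / 2 * norm (x + \<tau> *\<^sub>R y) + (1 - c) / 2 * norm (x + \<tau> *\<^sub>R (- y))"
      using c norm_triangle_ineq[of "((1 + c) / 2) *\<^sub>R (x + \<tau> *\<^sub>R y)" "((1 - c) / 2) *\<^sub>R (x + \<tau> *\<^sub>R (- y))"]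
      by simp
    also have "\<dots> \<le> (1 + c) / 2 * (1 + s) + (1 - c) / 2 * (1 + s)"
      using c by (intro add_mono mult_left_mono up y) auto
    also have "\<dots> = 1 + s" by (simp add: field_simps)
    finally show ?thesis .
  qed (use x s(2) in simp)
  with E(1) show ?thesis by blast
qed

lemma AUS_finite_codim:
  fixes p :: ereal
  assumes aus: "AUS p (norm :: 'a::real_normed_vector \<Rightarrow> real)" and q: "0 < q" "ereal q \<le> p"
  obtains C where "0 < C"
    "\<And>\<tau> (x :: 'a). 0 < \<tau> \<Longrightarrow> \<tau> < 1 \<Longrightarrow> norm x = 1 \<Longrightarrow>
      \<exists>E\<in>cof. \<forall>e\<in>E. norm e \<le> \<tau> \<longrightarrow> norm (x + e) \<le> 1 + C * \<tau> powr q"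
proof (cases "p = \<infinity>")
  case True
  then obtain \<tau>0 where \<tau>0: "0 < \<tau>0" "\<And>\<tau>. 0 \<le> \<tau> \<Longrightarrow> \<tau> < \<tau>0 \<Longrightarrow> aus_modulus (norm :: 'a \<Rightarrow> real) \<tau> = 0"
    using aus by (auto simp: AUS_def)
  \<comment> \<open>With this constant the bound is at least \<open>2\<close> once
    \<open>\<tau>\<close> reaches \<open>\<tau>0\<close>, and there the triangle inequality
    suffices.\<close>
  show thesis
  proof (rule that[of "\<tau>0 powr - q"])
    fix \<tau> :: real and x :: 'a assume \<tau>: "0 < \<tau>" "\<tau> < 1" and x: "norm x = 1"
    show "\<exists>E\<in>cof. \<forall>e\<in>E. norm e \<le> \<tau> \<longrightarrow> norm (x + e) \<le> 1 + \<tau>0 powr - q * \<tau> powr q"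
    proof (cases "\<tau> < \<tau>0")
      case True
      then show ?thesis using \<tau> \<tau>0 x by (intro aus_modulus_finite_codim) auto
    next
      case False
      have "1 \<le> (\<tau> / \<tau>0) powr q" using False \<tau>0 q by (intro ge_one_powr_ge_zero) auto
      also have "\<dots> = \<tau>0 powr - q * \<tau> powr q"
        using \<tau> \<tau>0 by (simp add: powr_divide powr_minus_divide)
      finally have "norm (x + e) \<le> 1 + \<tau>0 powr - q * \<tau> powr q" if "norm e \<le> \<tau>" for e
        using that norm_triangle_ineq[of x e] x \<tau> by linarith
      then show ?thesis using UNIV_in_cof by blast
    qed
  qed (use \<tau>0 in simp)
next
  case False
  then obtain C where C: "0 < C" "\<And>\<tau>. 0 < \<tau> \<Longrightarrow> \<tau> < 1 \<Longrightarrow>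
      aus_modulus (norm :: 'a \<Rightarrow> real) \<tau> \<le> C * \<tau> powr real_of_ereal p"
    using aus by (auto simp: AUS_def)
  have qp: "q \<le> real_of_ereal p" using False q by (cases p) auto
  \<comment> \<open>The factor \<open>2\<close> gives a strict inequality, since the infimum over
    subspaces need not be attained.\<close>
  show thesis
  proof (rule that[of "2 * C"])
    fix \<tau> :: real and x :: 'a assume \<tau>: "0 < \<tau>" "\<tau> < 1" and x: "norm x = 1"
    have "\<tau> powr real_of_ereal p \<le> \<tau> powr q" using \<tau> qp by (intro powr_mono') auto
    then have "aus_modulus (norm :: 'a \<Rightarrow> real) \<tau> \<le> C * \<tau> powr q"
      using C(1) C(2)[OF \<tau>] by (smt (verit) mult_left_mono)
    also have "\<dots> < 2 * C * \<tau> powr q" using C(1) \<tau> by simp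
    finally show "\<exists>E\<in>cof. \<forall>e\<in>E. norm e \<le> \<tau> \<longrightarrow> norm (x + e) \<le> 1 + 2 * C * \<tau> powr q"
      using \<tau> x C(1) by (intro aus_modulus_finite_codim) auto
  qed (use C in simp)
qed

text \<open>The only form in which closeness is used. Far from \<open>x0\<close> the limit gives the
  estimate; near \<open>x0\<close> the growth bound leaves a constant, which is small relative to
  \<open>R\<close>.\<close>

lemma asymptotically_close_idD:
  fixes h :: "'a::real_normed_vector \<Rightarrow> 'a"
  assumes close: "asymptotically_close h id" and lip: "\<And>x. norm (h x - h 0) \<le> M * norm x + M"
    and \<epsilon>: "0 < \<epsilon>" and K: "0 < K"
  shows "\<forall>\<^sub>F R in at_top. \<forall>x. norm x \<le> K * R \<longrightarrow> norm (h x - x) \<le> \<epsilon> * R"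
proof -
  obtain x0 where lim: "((\<lambda>x. dist (h x) x / dist x x0) \<longlongrightarrow> 0) (filtercomap (\<lambda>x. dist x x0) at_top)"
    using close by (auto simp: asymptotically_close_def)
  define \<delta> where "\<delta> = \<epsilon> / (2 * K)"
  have \<delta>: "0 < \<delta>" using \<epsilon> K by (simp add: \<delta>_def)
  from tendstoD[OF lim \<delta>] obtain P where P: "eventually P at_top" "\<And>x. P (dist x x0) \<Longrightarrow> dist (h x) x / dist x x0 < \<delta>"
    by (auto simp: eventually_filtercomap)
  then obtain T where T: "\<And>x. T \<le> dist x x0 \<Longrightarrow> dist (h x) x / dist x x0 < \<delta>"
    by (auto simp: eventually_at_top_linorder)
  define T' where "T' = max T 1"
  define B where "B = norm (h 0) + \<bar>M\<bar> * (norm x0 + T') + \<bar>M\<bar> + norm x0 + T'"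
  have "\<forall>\<^sub>F R in at_top. B + \<delta> * norm x0 \<le> \<epsilon> / 2 * R"
    using filterlim_tendsto_pos_mult_at_top[OF tendsto_const, of "\<epsilon> / 2" "\<lambda>R. R" at_top] \<epsilon>
    unfolding filterlim_at_top by (simp add: filterlim_ident del: times_divide_eq_left)
  moreover have "\<forall>\<^sub>F R :: real in at_top. 0 \<le> R" by (rule eventually_ge_at_top)
  ultimately show ?thesis
  proof eventually_elim
    case (elim R)
    show ?case
    proof (intro allI impI)
      fix x :: 'a assume x: "norm x \<le> K * R"
      show "norm (h x - x) \<le> \<epsilon> * R"
      proof (cases "T' \<le> dist x x0")
        case True
        then have "0 < dist x x0" "T \<le> dist x x0" by (auto simp: T'_def)
        then have "norm (h x - x) \<le> \<delta> * dist x x0"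
          using T[of x] by (simp add: dist_norm field_simps)
        also have "\<dots> \<le> \<delta> * (K * R + norm x0)"
          using \<delta> x norm_triangle_ineq4[of x x0] by (simp add: dist_norm)
        also have "\<dots> = \<epsilon> / 2 * R + \<delta> * norm x0"
          using K by (simp add: \<delta>_def field_simps)
        also have "\<dots> \<le> \<epsilon> * R"
          using elim by (smt (verit, best) B_def T'_def abs_ge_zero field_sum_of_halves mult_nonneg_nonneg norm_ge_zero ring_class.ring_distribs(2))
        finally show ?thesis .
      next
        case False
        then have nx: "norm x \<le> norm x0 + T'" using norm_triangle_sub[of x x0] by (simp add: dist_norm)
        have "norm (h x - h 0) \<le> \<bar>M\<bar> * norm x + \<bar>M\<bar>"
          using lip[of x] by (smt (verit) mult_right_mono norm_ge_zero)
        also have "\<dots> \<le> \<bar>M\<bar> * (norm x0 + T') + \<bar>M\<bar>" using nx by (simp add: mult_left_mono)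
        finally have "norm (h x - x) \<le> B"
          using nx norm_triangle_ineq4[of "h x" x] norm_triangle_sub[of "h x" "h 0"] by (simp add: B_def)
        then show ?thesis using elim \<delta> \<epsilon>
          by (smt (verit) divide_pos_pos field_sum_of_halves mult_nonneg_nonneg norm_ge_zero mult_right_mono)
      qed
    qed
  qed
qed

section \<open>Gauges on the dual\<close>

lemma dual_ball_linear: "\<phi> \<in> dual_ball D \<Longrightarrow> linear \<phi>"
  and dual_ball_abs_le: "\<phi> \<in> dual_ball D \<Longrightarrow> \<bar>\<phi> y\<bar> \<le> D * norm y"
  by (simp_all add: dual_ball_def)

lemma dual_ball_diff: "\<phi> \<in> dual_ball D \<Longrightarrow> \<phi> (x - y) = \<phi> x - \<phi> y"
  and dual_ball_add: "\<phi> \<in> dual_ball D \<Longrightarrow> \<phi> (x + y) = \<phi> x + \<phi> y"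
  and dual_ball_scaleR: "\<phi> \<in> dual_ball D \<Longrightarrow> \<phi> (c *\<^sub>R x) = c * \<phi> x"
  using linear_diff linear_add linear_cmul[where f = \<phi>, unfolded real_scaleR_def] dual_ball_linear by blast+

lemma dual_ball_mono: "\<phi> \<in> dual_ball D \<Longrightarrow> D \<le> D' \<Longrightarrow> \<phi> \<in> dual_ball D'"
  unfolding dual_ball_def using mult_right_mono[of D D' "norm _"] by (fastforce intro: order_trans)

lemma dual_ball_mult: "\<phi> \<in> dual_ball D \<Longrightarrow> (\<lambda>y. c * \<phi> y) \<in> dual_ball (\<bar>c\<bar> * D)"
  using mult_left_mono[of "\<bar>\<phi> x\<bar>" "D * norm x" "\<bar>c\<bar>" for x]
  by (auto simp: dual_ball_def linear_iff algebra_simps abs_mult)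

lemma eventually_nhds_fun_close:
  fixes \<phi> :: "'b \<Rightarrow> real"
  assumes "0 < \<epsilon>"
  shows "\<forall>\<^sub>F \<psi> in nhds \<phi>. \<bar>\<psi> y - \<phi> y\<bar> < \<epsilon>"
  using tendstoD[OF tendsto_fun_apply[where f = "\<lambda>x. x" and l = \<phi> and i = y, OF filterlim_ident] assms] by (simp add: dist_real_def)

text \<open>
  A gauge on the dual ball, uniformly equivalent to the dual norm and weak-* lower semicontinuous;
  the topology of pointwise convergence on \<open>'b \<Rightarrow> real\<close> plays the role of the weak-* topology.
\<close>

definition dual_gauge :: "real \<Rightarrow> (('b::real_normed_vector \<Rightarrow> real) \<Rightarrow> real) \<Rightarrow> bool" where
  "dual_gauge L P \<longleftrightarrow> (\<forall>D\<ge>0. \<forall>\<phi>\<in>dual_ball D. 0 \<le> P \<phi> \<and> P \<phi> \<le> 2 * L * D \<and> \<phi> \<in> dual_ball (4 * L * P \<phi>) \<and>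
     (\<forall>c. P (\<lambda>y. c * \<phi> y) = \<bar>c\<bar> * P \<phi>) \<and>
     (\<forall>\<eta>>0. \<forall>\<^sub>F \<psi> in nhds \<phi>. \<psi> \<in> dual_ball D \<longrightarrow> P \<phi> - \<eta> < P \<psi>))"

lemma dual_gaugeD:
  assumes "dual_gauge L P" "0 \<le> D" "\<phi> \<in> dual_ball D"
  shows "0 \<le> P \<phi>" "P \<phi> \<le> 2 * L * D" "\<phi> \<in> dual_ball (4 * L * P \<phi>)"
    "P (\<lambda>y. c * \<phi> y) = \<bar>c\<bar> * P \<phi>"
    "0 < \<eta> \<Longrightarrow> \<forall>\<^sub>F \<psi> in nhds \<phi>. \<psi> \<in> dual_ball D \<longrightarrow> P \<phi> - \<eta> < P \<psi>"
  using assms unfolding dual_gauge_def by blast+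

text \<open>
  Bounding the norms by \<open>r\<close> keeps all points in a region where \<open>G \<circ> F\<close> is uniformly close to the
  identity; asymptotic closeness, unlike coarse equivalence, is not translation invariant.
\<close>

definition pairs :: "real \<Rightarrow> real \<Rightarrow> ('a::real_normed_vector \<times> 'a) set" where
  "pairs \<theta> r = {(x, x'). \<theta> \<le> norm (x - x') \<and> norm x \<le> r \<and> norm x' \<le> r}"

section \<open>Slopes of a coarse Lipschitz map at large distances\<close>

definition slope :: "('a::real_normed_vector \<Rightarrow> 'b::real_normed_vector) \<Rightarrow> real \<Rightarrow> real \<Rightarrow> ('b \<Rightarrow> real) \<Rightarrow> real" where
  "slope F \<theta> r \<phi> = (SUP z\<in>pairs \<theta> r. \<phi> (F (fst z) - F (snd z)) / norm (fst z - snd z))"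

locale coarse_lipschitz_map =
  fixes F :: "'a::real_normed_vector \<Rightarrow> 'b::real_normed_vector" and L :: real
  assumes L: "1 \<le> L" and lip: "norm (F x - F x') \<le> L * norm (x - x') + L"
begin

text \<open>Distances in \<open>pairs \<theta> r\<close> are at least \<open>1\<close>, so the
  additive constant of \<open>lip\<close> is absorbed by doubling \<open>L\<close>.\<close>

lemma quotient_le:
  assumes \<theta>: "1 \<le> \<theta>" and D: "0 \<le> D" and \<phi>: "\<phi> \<in> dual_ball D" and z: "z \<in> pairs \<theta> r"
  shows "\<phi> (F (fst z) - F (snd z)) / norm (fst z - snd z) \<le> 2 * L * D"
proof -
  let ?n = "norm (fst z - snd z)"
  have n: "1 \<le> ?n" using \<theta> z by (auto simp: pairs_def)
  have "\<phi> (F (fst z) - F (snd z)) \<le> D * norm (F (fst z) - F (snd z))"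
    using dual_ball_abs_le[OF \<phi>] by (meson abs_le_D1)
  also have "\<dots> \<le> D * (2 * L * ?n)"
  proof (rule mult_left_mono[OF _ D])
    have "L \<le> L * ?n" using L n by (metis mult_left_mono mult.right_neutral order_trans zero_le_one)
    then show "norm (F (fst z) - F (snd z)) \<le> 2 * L * ?n" using lip[of "fst z" "snd z"] by linarith
  qed
  finally show ?thesis using n by (subst pos_divide_le_eq) (auto simp: mult_ac)
qed

lemma slope_bdd:
  assumes "1 \<le> \<theta>" "\<phi> \<in> dual_ball D"
  shows "bdd_above ((\<lambda>z. \<phi> (F (fst z) - F (snd z)) / norm (fst z - snd z)) ` pairs \<theta> r)"
  using quotient_le[OF assms(1) _ dual_ball_mono[OF assms(2)], of "max 0 D"] by (intro bdd_aboveI2) auto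

lemma slope_upper:
  assumes "1 \<le> \<theta>" "\<phi> \<in> dual_ball D" "(x, x') \<in> pairs \<theta> r"
  shows "\<phi> (F x - F x') \<le> slope F \<theta> r \<phi> * norm (x - x')"
proof -
  have "\<phi> (F x - F x') / norm (x - x') \<le> slope F \<theta> r \<phi>"
    using cSUP_upper[OF assms(3) slope_bdd[OF assms(1,2)]] by (simp add: slope_def)
  moreover have "0 < norm (x - x')" using assms(1,3) by (auto simp: pairs_def)
  ultimately show ?thesis by (simp add: divide_simps)
qed

lemma slope_le:
  assumes "1 \<le> \<theta>" "0 \<le> D" "\<phi> \<in> dual_ball D" "pairs \<theta> r \<noteq> ({} :: ('a \<times> 'a) set)"
  shows "slope F \<theta> r \<phi> \<le> 2 * L * D"
  unfolding slope_def using assms by (intro cSUP_least quotient_le) auto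

lemma slope_lessD:
  assumes "s < slope F \<theta> r \<phi>" "pairs \<theta> r \<noteq> ({} :: ('a \<times> 'a) set)"
  obtains x x' where "(x, x') \<in> pairs \<theta> r" "s < \<phi> (F x - F x') / norm (x - x')"
proof -
  have "\<exists>z\<in>pairs \<theta> r. s < \<phi> (F (fst z) - F (snd z)) / norm (fst z - snd z)"
  proof (rule ccontr)
    assume "\<not> ?thesis"
    then have "slope F \<theta> r \<phi> \<le> s"
      unfolding slope_def using assms(2) by (intro cSUP_least) (auto simp: not_less)
    with assms(1) show False by simp
  qed
  then show thesis using that by force
qed

text \<open>\<open>pairs\<close> is symmetric and \<open>\<phi>\<close> is odd, so the quotients
  occur with both signs.\<close>

lemma slope_nonneg:
  assumes \<theta>: "1 \<le> \<theta>" and \<phi>: "\<phi> \<in> dual_ball D" and ne: "pairs \<theta> r \<noteq> ({} :: ('a \<times> 'a) set)"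
  shows "0 \<le> slope F \<theta> r \<phi>"
proof -
  obtain x x' :: 'a where z: "(x, x') \<in> pairs \<theta> r" using ne by auto
  then have z': "(x', x) \<in> pairs \<theta> r" by (auto simp: pairs_def norm_minus_commute)
  have "0 < norm (x - x')" using z \<theta> by (auto simp: pairs_def)
  moreover have "0 \<le> slope F \<theta> r \<phi> * norm (x - x')"
    using slope_upper[OF \<theta> \<phi> z] slope_upper[OF \<theta> \<phi> z']
    by (simp add: dual_ball_diff[OF \<phi>] norm_minus_commute)
  ultimately show ?thesis by (simp add: zero_le_mult_iff)
qed

lemma slope_mult_le:
  assumes \<theta>: "1 \<le> \<theta>" and \<phi>: "\<phi> \<in> dual_ball D" and ne: "pairs \<theta> r \<noteq> ({} :: ('a \<times> 'a) set)"
  shows "slope F \<theta> r (\<lambda>y. c * \<phi> y) \<le> \<bar>c\<bar> * slope F \<theta> r \<phi>"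
  unfolding slope_def[of F \<theta> r "\<lambda>y. c * \<phi> y"]
proof (rule cSUP_least[OF ne])
  fix z :: "'a \<times> 'a" assume "z \<in> pairs \<theta> r"
  then obtain x x' where z: "z = (x, x')" "(x, x') \<in> pairs \<theta> r" by (cases z) auto
  then have z': "(x', x) \<in> pairs \<theta> r" by (auto simp: pairs_def norm_minus_commute)
  have n: "0 < norm (x - x')" using z \<theta> by (auto simp: pairs_def)
  have "\<bar>\<phi> (F x - F x')\<bar> \<le> slope F \<theta> r \<phi> * norm (x - x')"
    using slope_upper[OF \<theta> \<phi> z(2)] slope_upper[OF \<theta> \<phi> z']
    by (simp add: dual_ball_diff[OF \<phi>] norm_minus_commute abs_le_iff)
  then have "\<bar>c\<bar> * \<bar>\<phi> (F x - F x')\<bar> \<le> \<bar>c\<bar> * (slope F \<theta> r \<phi> * norm (x - x'))"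
    by (rule mult_left_mono) simp
  moreover have "c * \<phi> (F x - F x') \<le> \<bar>c\<bar> * \<bar>\<phi> (F x - F x')\<bar>"
    by (simp flip: abs_mult)
  ultimately show "c * \<phi> (F (fst z) - F (snd z)) / norm (fst z - snd z) \<le> \<bar>c\<bar> * slope F \<theta> r \<phi>"
    using n z(1) by (simp add: divide_simps)
qed

lemma slope_mult:
  assumes \<theta>: "1 \<le> \<theta>" and \<phi>: "\<phi> \<in> dual_ball D" and ne: "pairs \<theta> r \<noteq> ({} :: ('a \<times> 'a) set)"
  shows "slope F \<theta> r (\<lambda>y. c * \<phi> y) = \<bar>c\<bar> * slope F \<theta> r \<phi>"
proof (rule antisym)
  show "slope F \<theta> r (\<lambda>y. c * \<phi> y) \<le> \<bar>c\<bar> * slope F \<theta> r \<phi>" by (rule slope_mult_le[OF assms])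
  show "\<bar>c\<bar> * slope F \<theta> r \<phi> \<le> slope F \<theta> r (\<lambda>y. c * \<phi> y)"
  proof (cases "c = 0")
    case True
    then show ?thesis using slope_nonneg[OF \<theta> dual_ball_mult[OF \<phi>, of c] ne] by simp
  next
    case False
    then show ?thesis
      using slope_mult_le[OF \<theta> dual_ball_mult[OF \<phi>, of c] ne, of "1 / c"] by (simp add: field_simps)
  qed
qed

lemma slope_lsc:
  assumes \<theta>: "1 \<le> \<theta>" and \<phi>: "\<phi> \<in> dual_ball D" and ne: "pairs \<theta> r \<noteq> ({} :: ('a \<times> 'a) set)" and \<eta>: "0 < \<eta>"
  shows "\<forall>\<^sub>F \<psi> in nhds \<phi>. \<psi> \<in> dual_ball D \<longrightarrow> slope F \<theta> r \<phi> - \<eta> < slope F \<theta> r \<psi>"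
proof -
  have "slope F \<theta> r \<phi> - \<eta> < slope F \<theta> r \<phi>" using \<eta> by simp
  then obtain x x' where z: "(x, x') \<in> pairs \<theta> r" "slope F \<theta> r \<phi> - \<eta> < \<phi> (F x - F x') / norm (x - x')"
    using slope_lessD[OF _ ne] by blast
  have n: "0 < norm (x - x')" using z \<theta> by (auto simp: pairs_def)
  then have "0 < \<phi> (F x - F x') - (slope F \<theta> r \<phi> - \<eta>) * norm (x - x')"
    using z(2) by (simp add: divide_simps)
  from eventually_nhds_fun_close[OF this, of "F x - F x'" \<phi>] show ?thesis
  proof eventually_elim
    case (elim \<psi>)
    show ?case
    proof
      assume \<psi>: "\<psi> \<in> dual_ball D"
      have "(slope F \<theta> r \<phi> - \<eta>) * norm (x - x') < \<psi> (F x - F x')" using elim by linarith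
      also have "\<dots> \<le> slope F \<theta> r \<psi> * norm (x - x')" by (rule slope_upper[OF \<theta> \<psi> z(1)])
      finally show "slope F \<theta> r \<phi> - \<eta> < slope F \<theta> r \<psi>" using n by simp
    qed
  qed
qed

end

locale coarse_lipschitz_pair = F: coarse_lipschitz_map F L + G: coarse_lipschitz_map G L
  for F :: "'a::real_normed_vector \<Rightarrow> 'b::real_normed_vector" and G :: "'b \<Rightarrow> 'a" and L :: real
begin

text \<open>Coarse surjectivity of \<open>F\<close>: the images of \<open>G (t *\<^sub>R y)\<close>
  and \<open>G 0\<close> are within \<open>\<omega>\<close> of \<open>t *\<^sub>R y\<close> and
  \<open>0\<close>, so this pair tests \<open>\<phi>\<close> in direction \<open>y\<close>. The
  lower bound on \<open>t\<close> forces its distance to be at least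
  \<open>\<theta>\<close>.\<close>

lemma slope_lower:
  assumes \<theta>: "1 \<le> \<theta>" and t: "1 \<le> t" "L * \<theta> + L + 2 * \<omega> \<le> t" and r: "norm (G 0) + L * t + L \<le> r"
    and FG: "\<And>v. norm v \<le> t \<Longrightarrow> norm (F (G v) - v) \<le> \<omega>" and y: "norm y = 1"
  shows "(G (t *\<^sub>R y), G 0) \<in> pairs \<theta> r"
    "\<phi> \<in> dual_ball D \<Longrightarrow> 0 \<le> slope F \<theta> r \<phi> \<Longrightarrow> \<phi> y \<le> 2 * L * slope F \<theta> r \<phi> + 2 * \<omega> / t * D"
proof -
  define x x' where "x = G (t *\<^sub>R y)" and "x' = G 0"
  have n: "norm (x - x') \<le> L * t + L" using G.lip[of "t *\<^sub>R y" 0] t y by (simp add: x_def x'_def)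
  have e1: "norm (F x - t *\<^sub>R y) \<le> \<omega>" and e0: "norm (F x') \<le> \<omega>"
    using FG[of "t *\<^sub>R y"] FG[of 0] t(1) y by (simp_all add: x_def x'_def)
  define w where "w = t *\<^sub>R y - (F x - F x')"
  have w: "norm w \<le> 2 * \<omega>"
    using e0 e1 norm_triangle_ineq4[of "F x'" "F x - t *\<^sub>R y"] by (simp add: w_def algebra_simps)
  have "t = norm (t *\<^sub>R y)" using t y by simp
  also have "\<dots> \<le> norm (F x - F x') + norm w" using norm_triangle_ineq[of "F x - F x'" w] by (simp add: w_def)
  also have "\<dots> \<le> L * norm (x - x') + L + 2 * \<omega>" using F.lip[of x x'] w by linarith
  finally have "L * \<theta> \<le> L * norm (x - x')" using t(2) by linarith
  then have "\<theta> \<le> norm (x - x')" using F.L by simp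
  moreover have "norm x \<le> r" using norm_triangle_sub[of x x'] n r by (simp add: x'_def)
  moreover have "norm x' \<le> r"
  proof -
    have "0 \<le> L * t" using F.L t(1) by simp
    then show ?thesis using r F.L unfolding x'_def by linarith
  qed
  ultimately show z: "(G (t *\<^sub>R y), G 0) \<in> pairs \<theta> r" by (simp add: pairs_def x_def x'_def)
  assume \<phi>: "\<phi> \<in> dual_ball D" and s0: "0 \<le> slope F \<theta> r \<phi>"
  have D: "0 \<le> D" using dual_ball_abs_le[OF \<phi>, of y] y by simp
  have "t * \<phi> y = \<phi> (F x - F x') + \<phi> w"
    by (simp add: w_def dual_ball_scaleR[OF \<phi>] dual_ball_diff[OF \<phi>])
  also have "\<dots> \<le> slope F \<theta> r \<phi> * norm (x - x') + D * norm w"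
    using F.slope_upper[OF \<theta> \<phi> z] dual_ball_abs_le[OF \<phi>, of w] by (simp add: x_def x'_def)
  also have "\<dots> \<le> slope F \<theta> r \<phi> * (2 * L * t) + D * (2 * \<omega>)"
  proof (intro add_mono mult_left_mono w s0 D)
    have "L \<le> L * t" using F.L t by simp
    then show "norm (x - x') \<le> 2 * L * t" using n by linarith
  qed
  finally show "\<phi> y \<le> 2 * L * slope F \<theta> r \<phi> + 2 * \<omega> / t * D"
    using t by (simp add: field_simps)
qed

end

section \<open>Approximate midpoints and their images\<close>

context coarse_lipschitz_pair
begin

text \<open>\<open>m + e\<close> is close to \<open>G (F (m + a) + y)\<close>; where
  \<open>F\<close> nearly inverts \<open>G\<close>, this places \<open>F (m + e)\<close> close to
  \<open>F (m + a)\<close> displaced by \<open>y\<close>. The perturbation is by at most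
  \<open>L * \<beta> + L + \<omega>\<close>, and two coarse Lipschitz bounds in succession give its
  oscillation \<open>2 * L ^ 2 + L\<close> at scale \<open>1\<close>.\<close>

lemma gorelik:
  assumes E: "E \<in> cof" and \<beta>: "0 \<le> \<beta>" and \<omega>: "0 \<le> \<omega>"
    and GF: "\<And>x. norm (x - m) \<le> L * \<beta> + L + \<omega> \<Longrightarrow> norm (G (F x) - x) \<le> \<omega>"
  obtains A where "finite A" "\<And>a. a \<in> A \<Longrightarrow> norm a \<le> L * \<beta> + L + \<omega>"
    "\<And>y. norm y \<le> \<beta> \<Longrightarrow> \<exists>a\<in>A. \<exists>e\<in>E. norm (m + e - G (F (m + a) + y)) \<le> 2 * L ^ 2 + L + 1 \<and>
      norm e \<le> 2 * (L * \<beta> + L + \<omega>) + 2 * L ^ 2 + L + 1"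
proof -
  define d where "d = L * \<beta> + L + \<omega>"
  have d: "0 \<le> d" using F.L \<beta> \<omega> by (simp add: d_def)
  obtain A where A: "finite A" "\<And>a. a \<in> A \<Longrightarrow> norm a \<le> d"
    and meet: "\<And>\<Phi> \<kappa>. (\<And>a. a \<in> A \<Longrightarrow> norm (\<Phi> a - a) \<le> d) \<Longrightarrow>
      (\<And>a a'. a \<in> A \<Longrightarrow> a' \<in> A \<Longrightarrow> norm (a - a') < 1 \<Longrightarrow> norm (\<Phi> a - \<Phi> a') \<le> \<kappa>) \<Longrightarrow>
      \<exists>a\<in>A. \<exists>e\<in>E. norm (e - \<Phi> a) \<le> \<kappa> + 1"
    using finite_codim_meets_perturbation[OF E d, of 1 1] by (metis zero_less_one)
  show thesis
  proof (rule that[OF A(1)])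
    show "norm a \<le> L * \<beta> + L + \<omega>" if "a \<in> A" for a using A(2)[OF that] by (simp add: d_def)
    fix y :: 'b assume y: "norm y \<le> \<beta>"
    define \<Phi> where "\<Phi> a = G (F (m + a) + y) - m" for a
    have move: "norm (\<Phi> a - a) \<le> d" if a: "a \<in> A" for a
    proof -
      have "norm (G (F (m + a) + y) - G (F (m + a))) \<le> L * norm y + L"
        using G.lip[of "F (m + a) + y" "F (m + a)"] by simp
      also have "\<dots> \<le> L * \<beta> + L" using y F.L by simp
      finally have 1: "norm (G (F (m + a) + y) - G (F (m + a))) \<le> L * \<beta> + L" .
      have 2: "norm (G (F (m + a)) - (m + a)) \<le> \<omega>" using GF[of "m + a"] A(2)[OF a] by (simp add: d_def)
      have "\<Phi> a - a = (G (F (m + a) + y) - G (F (m + a))) + (G (F (m + a)) - (m + a))"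
        by (simp add: \<Phi>_def)
      then show ?thesis using 1 2 norm_triangle_ineq unfolding d_def by (smt (verit))
    qed
    have osc: "norm (\<Phi> a - \<Phi> a') \<le> 2 * L ^ 2 + L" if "norm (a - a') < 1" for a a'
    proof -
      have "norm (F (m + a) - F (m + a')) \<le> L * norm (a - a') + L" using F.lip[of "m + a" "m + a'"] by simp
      also have "\<dots> \<le> 2 * L" using that F.L by simp
      finally have "L * norm (F (m + a) - F (m + a')) + L \<le> L * (2 * L) + L" using F.L by simp
      then show ?thesis using G.lip[of "F (m + a) + y" "F (m + a') + y"] by (simp add: \<Phi>_def power2_eq_square)
    qed
    obtain a e where ae: "a \<in> A" "e \<in> E" "norm (e - \<Phi> a) \<le> 2 * L ^ 2 + L + 1"
      using meet[of \<Phi>, OF move osc] by blast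
    have "norm e \<le> norm (e - \<Phi> a) + norm (\<Phi> a - a) + norm a"
      using norm_triangle_ineq[of "e - \<Phi> a" "\<Phi> a - a + a"] norm_triangle_ineq[of "\<Phi> a - a" a] by simp
    then have "norm e \<le> 2 * d + 2 * L ^ 2 + L + 1" using ae move[OF ae(1)] A(2)[OF ae(1)] by linarith
    moreover have "m + e - G (F (m + a) + y) = e - \<Phi> a" by (simp add: \<Phi>_def)
    then have "norm (m + e - G (F (m + a) + y)) \<le> 2 * L ^ 2 + L + 1" using ae(3) by (simp only:)
    ultimately show "\<exists>a\<in>A. \<exists>e\<in>E. norm (m + e - G (F (m + a) + y)) \<le> 2 * L ^ 2 + L + 1 \<and>
      norm e \<le> 2 * (L * \<beta> + L + \<omega>) + 2 * L ^ 2 + L + 1"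
      using ae(1,2) unfolding d_def by blast
  qed
qed

text \<open>
  For \<open>x, x'\<close> nearly attaining the slope of \<open>\<phi>\<close>, the Gorelik principle yields an approximate
  midpoint \<open>b\<close> of \<open>x, x'\<close> for which \<open>F b\<close> is displaced by a prescribed multiple of \<open>- z\<close>, up to a
  finite set on which \<open>\<psi>\<close> and \<open>\<phi>\<close> nearly agree. The loss
  \<open>slope F \<theta>' (2 * r) \<phi> - slope F \<theta> r \<phi>\<close> telescopes when averaged over scales.
\<close>

lemma slope_gain:
  assumes \<tau>: "0 < \<tau>" "\<tau> \<le> 1 / 2" and \<delta>: "0 < \<delta>"
    and smooth: "\<And>x :: 'a. norm x = 1 \<Longrightarrow> \<exists>E\<in>cof. \<forall>e\<in>E. norm e \<le> \<tau> \<longrightarrow> norm (x + e) \<le> 1 + \<delta>"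
    and D: "0 \<le> D" and \<phi>: "\<phi> \<in> dual_ball D" and \<theta>': "1 \<le> \<theta>'" and \<theta>: "4 * \<theta>' \<le> \<theta>" and \<omega>: "0 \<le> \<omega>"
    and GF: "\<And>x. norm x \<le> 2 * r \<Longrightarrow> norm (G (F x) - x) \<le> \<omega>"
    and FG: "\<And>v. norm v \<le> norm (F 0) + L * (2 * r) + L + r \<Longrightarrow> norm (F (G v) - v) \<le> \<omega>"
    and i: "2 * (L + \<omega>) + 2 * L ^ 2 + L + 1 \<le> \<tau> * \<theta> / 4"
    and ii: "2 * D * (L * (2 * L ^ 2 + L + 2) + \<omega>) + 1 \<le> \<delta> * \<theta> / 2"
    and ne: "pairs \<theta> r \<noteq> ({} :: ('a \<times> 'a) set)"
  shows "\<forall>\<^sub>F \<psi> in nhds \<phi>. \<psi> \<in> dual_ball D \<longrightarrow> (\<forall>z. norm z \<le> 1 \<longrightarrow>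
    2 * slope F \<theta> r \<phi> - slope F \<theta>' (2 * r) \<phi> + \<tau> / (4 * L) * (\<psi> z - \<phi> z) - (3 + 4 * L * D) * \<delta>
      \<le> slope F \<theta>' (2 * r) \<psi>)"
proof -
  have L: "1 \<le> L" by (rule F.L)
  have "slope F \<theta> r \<phi> - \<delta> < slope F \<theta> r \<phi>" using \<delta> by simp
  from F.slope_lessD[OF this ne] obtain x x' where z: "(x, x') \<in> pairs \<theta> r"
    and near: "slope F \<theta> r \<phi> - \<delta> < \<phi> (F x - F x') / norm (x - x')" by blast
  have xx: "\<theta> \<le> norm (x - x')" "norm x \<le> r" "norm x' \<le> r" using z by (auto simp: pairs_def)
  define u where "u = (1 / 2) *\<^sub>R (x - x')"
  define m where "m = (1 / 2) *\<^sub>R (x + x')"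
  define l where "l = norm u"
  have l2: "norm (x - x') = 2 * l" by (simp add: l_def u_def)
  have l: "\<theta> \<le> 2 * l" "0 < l" "l \<le> r" "norm m \<le> r"
    using xx \<theta> \<theta>' l2 norm_triangle_ineq4[of x x'] norm_triangle_ineq[of x x'] by (auto simp: m_def)
  have xm: "x = m + u" "x' = m - u"
    by (simp_all add: m_def u_def scaleR_add_right scaleR_diff_right flip: scaleR_add_left)
  have "norm ((1 / l) *\<^sub>R u) = 1" using l by (simp add: l_def)
  from smooth[OF this] obtain E where E: "E \<in> cof"
    and sm: "\<And>e. e \<in> E \<Longrightarrow> norm e \<le> \<tau> \<Longrightarrow> norm ((1 / l) *\<^sub>R u + e) \<le> 1 + \<delta>" by blast
  have sE: "subspace E" using E by (simp add: cof_def)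
  \<comment> \<open>\<open>E\<close> is symmetric, so \<open>m + e\<close> has distance at most
    \<open>l * (1 + \<delta>)\<close> to both \<open>x\<close> and \<open>x'\<close>: it is an
    approximate midpoint.\<close>
  have mid: "norm (u + e) \<le> l * (1 + \<delta>)" if e: "e \<in> E" "norm e \<le> \<tau> * l" for e
  proof -
    have "norm ((1 / l) *\<^sub>R u + (1 / l) *\<^sub>R e) \<le> 1 + \<delta>"
      using e l by (intro sm subspace_scale sE) (auto simp: divide_simps mult_ac)
    then have "norm ((1 / l) *\<^sub>R (u + e)) \<le> 1 + \<delta>" by (simp add: scaleR_add_right)
    then have "norm (u + e) / l \<le> 1 + \<delta>" using l by simp
    then show ?thesis using l by (simp add: pos_divide_le_eq mult.commute)
  qed
  have tl: "\<tau> * l \<le> l / 2" using \<tau> l mult_right_mono[of \<tau> "1 / 2" l] by simp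
  \<comment> \<open>Half of the allowed \<open>\<tau> * l\<close> pays for
    \<open>2 * (L * \<beta>)\<close>, the other half for the constants in \<open>i\<close>. The
    quotient \<open>\<beta> / l\<close> is the coefficient \<open>\<tau> / (4 * L)\<close> of the
    conclusion.\<close>
  define \<beta> where "\<beta> = \<tau> * l / (4 * L)"
  have \<beta>: "0 \<le> \<beta>" "4 * (L * \<beta>) = \<tau> * l" using \<tau> l L by (simp_all add: \<beta>_def)
  have "\<tau> * \<theta> \<le> \<tau> * (2 * l)" using \<tau> l by (intro mult_left_mono) auto
  then have i': "2 * (L + \<omega>) + 2 * L ^ 2 + L + 1 \<le> \<tau> * l / 2" using i by simp
  have "\<delta> * \<theta> \<le> \<delta> * (2 * l)" using \<delta> l by (intro mult_left_mono) auto
  then have ii': "2 * D * (L * (2 * L ^ 2 + L + 2) + \<omega>) + 1 \<le> \<delta> * l" using ii by simp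
  have e_bd: "2 * (L * \<beta> + L + \<omega>) + 2 * L ^ 2 + L + 1 \<le> \<tau> * l" using i' \<beta>(2) by simp
  have d_bd: "L * \<beta> + L + \<omega> \<le> r"
  proof -
    have "2 * (L * \<beta> + L + \<omega>) \<le> \<tau> * l" 
    proof -
      have "2 * (L * \<beta> + L + \<omega>) \<le> 2 * (L * \<beta> + L + \<omega>) + (2 * L ^ 2 + L + 1)"
        using L by (simp add: add_nonneg_nonneg)
      then show ?thesis using e_bd by linarith
    qed
    then have "2 * (L * \<beta> + L + \<omega>) \<le> l / 2" using tl by (rule order_trans)
    then show ?thesis using l by simp
  qed
  have "norm (G (F v) - v) \<le> \<omega>" if "norm (v - m) \<le> L * \<beta> + L + \<omega>" for v
    using that d_bd l(4) norm_triangle_sub[of v m] by (intro GF) linarith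
  from gorelik[OF E \<beta>(1) \<omega> this] obtain A where A: "finite A"
    and Ad: "\<And>a. a \<in> A \<Longrightarrow> norm a \<le> L * \<beta> + L + \<omega>"
    and Aex: "\<And>y. norm y \<le> \<beta> \<Longrightarrow> \<exists>a\<in>A. \<exists>e\<in>E. norm (m + e - G (F (m + a) + y)) \<le> 2 * L ^ 2 + L + 1 \<and>
      norm e \<le> 2 * (L * \<beta> + L + \<omega>) + 2 * L ^ 2 + L + 1"
    by blast
  have fin: "finite (insert (F x) ((\<lambda>a. F (m + a)) ` A))" using A by simp
  \<comment> \<open>The two discrepancies used below, at \<open>F x\<close> and at one
    \<open>F (m + a)\<close>, add up to at most \<open>1\<close>, which is the summand
    \<open>1\<close> in \<open>ii\<close>.\<close>
  have "\<forall>\<^sub>F \<psi> in nhds \<phi>. \<forall>v\<in>insert (F x) ((\<lambda>a. F (m + a)) ` A). \<bar>\<psi> v - \<phi> v\<bar> < 1 / 2"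
    by (rule eventually_ball_finite[OF fin]) (intro ballI eventually_nhds_fun_close, simp)
  then show ?thesis
  proof eventually_elim
    case (elim \<psi>)
    show ?case
    proof (intro impI allI)
      fix z :: 'b assume \<psi>: "\<psi> \<in> dual_ball D" and z1: "norm z \<le> 1"
      \<comment> \<open>The minus sign turns the displacement into a gain of
        \<open>\<beta> * (\<psi> z - \<phi> z)\<close> when \<open>\<psi>\<close> replaces
        \<open>\<phi>\<close> on \<open>F x - F b\<close>.\<close>
      define y where "y = - \<beta> *\<^sub>R z"
      have y: "norm y \<le> \<beta>" using z1 \<beta> by (simp add: y_def mult_left_le)
      obtain a e where a: "a \<in> A" and e: "e \<in> E" and ae: "norm (m + e - G (F (m + a) + y)) \<le> 2 * L ^ 2 + L + 1"
        and en: "norm e \<le> \<tau> * l" using Aex[OF y] e_bd by (meson order_trans)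
      define b where "b = m + e"
      define err where "err = F b - (F (m + a) + y)"
      have ma: "norm (m + a) \<le> 2 * r" using norm_triangle_ineq[of m a] Ad[OF a] d_bd l by linarith
      have "L * norm (m + a) \<le> L * (2 * r)" using ma L by simp
      then have "norm (F (m + a)) \<le> norm (F 0) + L * (2 * r) + L"
        using F.lip[of "m + a" 0] norm_triangle_sub[of "F (m + a)" "F 0"] by simp
      moreover have "\<beta> \<le> r"
      proof -
        have "\<beta> \<le> 4 * (L * \<beta>)" using \<beta>(1) L mult_right_mono[of 1 L \<beta>] by simp
        then show ?thesis using \<beta>(2) tl l by linarith
      qed
      ultimately have "norm (F (m + a) + y) \<le> norm (F 0) + L * (2 * r) + L + r"
        using y norm_triangle_ineq[of "F (m + a)" y] by linarith
      from FG[OF this] have 1: "norm (F (G (F (m + a) + y)) - (F (m + a) + y)) \<le> \<omega>" .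
      have "L * norm (b - G (F (m + a) + y)) \<le> L * (2 * L ^ 2 + L + 1)" using ae L by (simp add: b_def)
      then have "norm (F b - F (G (F (m + a) + y))) \<le> L * (2 * L ^ 2 + L + 2)"
        using F.lip[of b "G (F (m + a) + y)"] by (simp add: algebra_simps)
      with 1 have err: "norm err \<le> L * (2 * L ^ 2 + L + 2) + \<omega>"
        using norm_diff_triangle_le unfolding err_def by (metis add.commute)
      have bn: "norm b \<le> 2 * r" using en tl l norm_triangle_ineq[of m e] unfolding b_def by linarith
      have xb: "x - b = u + - e" and bx: "b - x' = u + e" by (simp_all add: xm b_def)
      \<comment> \<open>Each half has length at least \<open>l - \<tau> * l\<close>, hence at least
        \<open>\<theta> / 4\<close>; this is the reason for
        \<open>4 * \<theta>' \<le> \<theta>\<close>.\<close>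
      have le4: "\<theta>' \<le> norm (u + w)" if "norm w \<le> \<tau> * l" for w
      proof -
        have "l - norm w \<le> norm (u + w)" using norm_triangle_ineq2[of u "- w"] by (simp add: l_def)
        then show ?thesis using that tl l \<theta> by linarith
      qed
      have p1: "(x, b) \<in> pairs \<theta>' (2 * r)" and p2: "(b, x') \<in> pairs \<theta>' (2 * r)"
        using le4[of "- e"] le4[of e] en bn xx xb bx l by (simp_all add: pairs_def)
      define s where "s = slope F \<theta>' (2 * r) \<psi>"
      define n0 where "n0 = slope F \<theta>' (2 * r) \<phi>"
      define n1 where "n1 = slope F \<theta> r \<phi>"
      define g where "g = \<psi> z - \<phi> z"
      have ne': "pairs \<theta>' (2 * r) \<noteq> ({} :: ('a \<times> 'a) set)" using p1 by blast
      have s: "0 \<le> s" "s \<le> 2 * L * D" and n0: "0 \<le> n0" "n0 \<le> 2 * L * D"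
        unfolding s_def n0_def
        using F.slope_nonneg[OF \<theta>' \<psi> ne'] F.slope_le[OF \<theta>' D \<psi> ne'] F.slope_nonneg[OF \<theta>' \<phi> ne'] F.slope_le[OF \<theta>' D \<phi> ne']
        by auto
      have A1: "(n1 - \<delta>) * (2 * l) \<le> \<phi> (F x - F x')"
        using near l l2 by (simp add: n1_def divide_simps)
      have A2: "\<phi> (F b - F x') \<le> n0 * (l * (1 + \<delta>))"
        using F.slope_upper[OF \<theta>' \<phi> p2] mult_left_mono[OF mid[OF e en] n0(1)] by (simp add: n0_def bx)
      have A3: "\<psi> (F x - F b) \<le> s * (l * (1 + \<delta>))"
        using F.slope_upper[OF \<theta>' \<psi> p1] mult_left_mono[OF mid[OF subspace_neg[OF sE e]] s(1)] en by (simp add: s_def xb)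
      have Fb: "F b = F (m + a) + y + err" by (simp add: err_def)
      have c1: "\<bar>\<psi> (F x) - \<phi> (F x)\<bar> < 1 / 2" "\<bar>\<psi> (F (m + a)) - \<phi> (F (m + a))\<bar> < 1 / 2"
        using elim a by auto
      have c2: "\<bar>\<psi> err\<bar> \<le> D * (L * (2 * L ^ 2 + L + 2) + \<omega>)" "\<bar>\<phi> err\<bar> \<le> D * (L * (2 * L ^ 2 + L + 2) + \<omega>)"
        using dual_ball_abs_le[OF \<psi>, of err] dual_ball_abs_le[OF \<phi>, of err] mult_left_mono[OF err D] by linarith+
      have c3: "\<psi> y = - \<beta> * \<psi> z" "\<phi> y = - \<beta> * \<phi> z"
        using dual_ball_scaleR[OF \<psi>, of "- \<beta>" z] dual_ball_scaleR[OF \<phi>, of "- \<beta>" z] by (simp_all add: y_def)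
      \<comment> \<open>\<open>\<phi>\<close> nearly attains \<open>n1\<close> on the pair
        \<open>x, x'\<close>, and the half from \<open>b\<close> to \<open>x'\<close> contributes at
        most about \<open>n0 * l\<close>. The rest falls on the half from \<open>x\<close> to
        \<open>b\<close>, where \<open>\<phi>\<close> is exchanged for
        \<open>\<psi>\<close>.\<close>
      have "(n1 - \<delta>) * (2 * l) - n0 * (l * (1 + \<delta>)) + \<beta> * g - \<delta> * l \<le> s * (l * (1 + \<delta>))"
      proof -
        have "\<psi> (F x - F b) = \<phi> (F x - F x') - \<phi> (F b - F x') + (\<psi> (F x) - \<phi> (F x)) - (\<psi> (F b) - \<phi> (F b))"
          by (simp add: dual_ball_diff[OF \<psi>] dual_ball_diff[OF \<phi>])
        moreover have "\<psi> (F b) - \<phi> (F b) = (\<psi> (F (m + a)) - \<phi> (F (m + a))) - \<beta> * g + (\<psi> err - \<phi> err)"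
          by (simp add: Fb dual_ball_add[OF \<psi>] dual_ball_add[OF \<phi>] c3 g_def algebra_simps)
        ultimately show ?thesis using A1 A2 A3 c1 c2 ii' by linarith
      qed
      then have "l * (2 * (n1 - \<delta>) - n0 * (1 + \<delta>) + \<tau> / (4 * L) * g - \<delta>) \<le> l * (s * (1 + \<delta>))"
        by (simp add: \<beta>_def algebra_simps)
      then have "2 * (n1 - \<delta>) - n0 * (1 + \<delta>) + \<tau> / (4 * L) * g - \<delta> \<le> s * (1 + \<delta>)"
        using l by simp
      moreover have "s * \<delta> \<le> 2 * L * D * \<delta>" "n0 * \<delta> \<le> 2 * L * D * \<delta>"
        using s n0 \<delta> by (simp_all add: mult_right_mono)
      ultimately have "2 * n1 - n0 + \<tau> / (4 * L) * g - (3 + 4 * L * D) * \<delta> \<le> s"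
        by (simp add: algebra_simps)
      then show "2 * slope F \<theta> r \<phi> - slope F \<theta>' (2 * r) \<phi> + \<tau> / (4 * L) * (\<psi> z - \<phi> z) - (3 + 4 * L * D) * \<delta>
        \<le> slope F \<theta>' (2 * r) \<psi>" by (simp add: s_def n0_def n1_def g_def)
    qed
  qed
qed

end

section \<open>Countable convex mixtures of gauges\<close>

lemma dual_gauge_suminf:
  fixes P :: "nat \<Rightarrow> ('b::real_normed_vector \<Rightarrow> real) \<Rightarrow> real"
  assumes g: "\<And>j. dual_gauge L (P j)" and w0: "\<And>j. 0 \<le> w j" and w1: "w sums 1"
    and D: "0 \<le> D" and \<phi>: "\<phi> \<in> dual_ball D"
  shows "summable (\<lambda>j. w j * P j \<phi>)"
proof (rule summable_comparison_test')
  show "summable (\<lambda>j. w j * (2 * L * D))" using w1 by (intro summable_mult2) (rule sums_summable)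
  show "norm (w j * P j \<phi>) \<le> w j * (2 * L * D)" for j
    using dual_gaugeD(1,2)[OF g D \<phi>] w0 by (simp add: abs_mult mult_left_mono)
qed

text \<open>Component \<open>k\<close> is kept exact. Finitely many others lose little by lower
  semicontinuity; the tail is small for \<open>\<phi>\<close> by summability and is dropped for
  \<open>\<psi>\<close> by nonnegativity.\<close>

lemma mixture_lower_bound:
  fixes P :: "nat \<Rightarrow> ('b::real_normed_vector \<Rightarrow> real) \<Rightarrow> real"
  assumes g: "\<And>j. dual_gauge L (P j)" and w0: "\<And>j. 0 \<le> w j" and w1: "w sums 1"
    and D: "0 \<le> D" and \<phi>: "\<phi> \<in> dual_ball D" and \<eta>: "0 < \<eta>"
  shows "\<forall>\<^sub>F \<psi> in nhds \<phi>. \<psi> \<in> dual_ball D \<longrightarrow>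
    (\<Sum>j. w j * P j \<phi>) + w k * (P k \<psi> - P k \<phi>) - \<eta> < (\<Sum>j. w j * P j \<psi>)"
proof -
  note sm = dual_gauge_suminf[OF g w0 w1 D]
  have "(\<lambda>J. \<Sum>j<J. w j * P j \<phi>) \<longlonglongrightarrow> (\<Sum>j. w j * P j \<phi>)"
    using sm[OF \<phi>] by (simp add: summable_LIMSEQ)
  from order_tendstoD(1)[OF this, of "(\<Sum>j. w j * P j \<phi>) - \<eta> / 2"]
  have "\<forall>\<^sub>F J in sequentially. (\<Sum>j. w j * P j \<phi>) - \<eta> / 2 < (\<Sum>j<J. w j * P j \<phi>)" using \<eta> by simp
  from eventually_conj[OF this eventually_gt_at_top[of k]]
  obtain J where J: "(\<Sum>j. w j * P j \<phi>) - \<eta> / 2 < (\<Sum>j<J. w j * P j \<phi>)" "k < J"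
    by (auto dest: eventually_happens)
  have "\<forall>\<^sub>F \<psi> in nhds \<phi>. \<forall>j\<in>{..<J}. \<psi> \<in> dual_ball D \<longrightarrow> P j \<phi> - \<eta> / 2 < P j \<psi>"
    using \<eta> by (intro eventually_ball_finite ballI dual_gaugeD(5)[OF g D \<phi>]) auto
  then show ?thesis
  proof eventually_elim
    case (elim \<psi>)
    show ?case
    proof
      assume \<psi>: "\<psi> \<in> dual_ball D"
      have "(\<Sum>j\<in>{..<J}-{k}. w j * P j \<phi>) - \<eta> / 2 * (\<Sum>j\<in>{..<J}-{k}. w j)
          = (\<Sum>j\<in>{..<J}-{k}. w j * (P j \<phi> - \<eta> / 2))"
        by (simp add: algebra_simps sum_subtractf sum_distrib_left sum_divide_distrib)
      also have "\<dots> \<le> (\<Sum>j\<in>{..<J}-{k}. w j * P j \<psi>)"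
        using elim \<psi> w0 by (intro sum_mono mult_left_mono) (auto intro: less_imp_le)
      finally have 1: "(\<Sum>j\<in>{..<J}-{k}. w j * P j \<phi>) - \<eta> / 2 * (\<Sum>j\<in>{..<J}-{k}. w j) \<le> (\<Sum>j\<in>{..<J}-{k}. w j * P j \<psi>)" .
      have "(\<Sum>j\<in>{..<J}-{k}. w j) \<le> (\<Sum>j. w j)" using w0 w1 by (intro sum_le_suminf) (auto simp: sums_iff)
      then have "\<eta> / 2 * (\<Sum>j\<in>{..<J}-{k}. w j) \<le> \<eta> / 2 * 1" using w1 \<eta> by (intro mult_left_mono) (auto simp: sums_iff)
      with 1 have 2: "(\<Sum>j\<in>{..<J}-{k}. w j * P j \<phi>) - \<eta> / 2 \<le> (\<Sum>j\<in>{..<J}-{k}. w j * P j \<psi>)" by simp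
      have split: "(\<Sum>j<J. w j * P j \<xi>) = w k * P k \<xi> + (\<Sum>j\<in>{..<J}-{k}. w j * P j \<xi>)" for \<xi>
        using J(2) by (intro sum.remove) auto
      have "(\<Sum>j<J. w j * P j \<psi>) \<le> (\<Sum>j. w j * P j \<psi>)"
        using sm[OF \<psi>] w0 dual_gaugeD(1)[OF g D \<psi>] by (intro sum_le_suminf) auto
      then show "(\<Sum>j. w j * P j \<phi>) + w k * (P k \<psi> - P k \<phi>) - \<eta> < (\<Sum>j. w j * P j \<psi>)"
        using 2 J(1) split[of \<phi>] split[of \<psi>] by (simp add: right_diff_distrib)
    qed
  qed
qed

text \<open>Serves two mixtures: equal weights over the finitely many scales of one level, and
  geometric weights over all levels. The constant \<open>L\<close> survives because all components
  share it.\<close>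

lemma dual_gauge_mixture:
  fixes P :: "nat \<Rightarrow> ('b::real_normed_vector \<Rightarrow> real) \<Rightarrow> real"
  assumes L: "0 \<le> L" and g: "\<And>j. dual_gauge L (P j)" and w0: "\<And>j. 0 \<le> w j" and w1: "w sums 1"
  shows "dual_gauge L (\<lambda>\<phi>. \<Sum>j. w j * P j \<phi>)"
  unfolding dual_gauge_def
proof (intro allI impI ballI conjI)
  fix D :: real and \<phi> :: "'b \<Rightarrow> real" assume D: "0 \<le> D" and \<phi>: "\<phi> \<in> dual_ball D"
  note sm = dual_gauge_suminf[OF g w0 w1 D \<phi>]
  show "0 \<le> (\<Sum>j. w j * P j \<phi>)" using sm w0 dual_gaugeD(1)[OF g D \<phi>] by (intro suminf_nonneg) auto
  have ws: "summable (\<lambda>j. w j * c)" "(\<Sum>j. w j * c) = c" for c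
    using sums_mult2[OF w1, of c] by (auto simp: sums_iff)
  have "(\<Sum>j. w j * P j \<phi>) \<le> (\<Sum>j. w j * (2 * L * D))"
    by (intro suminf_le mult_left_mono dual_gaugeD(2)[OF g D \<phi>] w0 sm ws)
  then show "(\<Sum>j. w j * P j \<phi>) \<le> 2 * L * D" by (simp add: ws)
  have "\<bar>\<phi> y\<bar> \<le> 4 * L * (\<Sum>j. w j * P j \<phi>) * norm y" for y
  proof -
    have "\<bar>\<phi> y\<bar> = (\<Sum>j. w j * \<bar>\<phi> y\<bar>)" by (simp add: ws)
    also have "\<dots> \<le> (\<Sum>j. w j * P j \<phi> * (4 * L * norm y))"
    proof (rule suminf_le)
      fix j
      have "\<bar>\<phi> y\<bar> \<le> P j \<phi> * (4 * L * norm y)"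
        using dual_ball_abs_le[OF dual_gaugeD(3)[OF g D \<phi>], of y j] by (simp add: mult_ac)
      then show "w j * \<bar>\<phi> y\<bar> \<le> w j * P j \<phi> * (4 * L * norm y)"
        using w0 by (simp add: mult.assoc mult_left_mono)
    qed (use ws sm in \<open>auto intro: summable_mult2\<close>)
    also have "\<dots> = (\<Sum>j. w j * P j \<phi>) * (4 * L * norm y)" by (rule suminf_mult2[OF sm, symmetric])
    finally show ?thesis by (simp add: mult_ac)
  qed
  then show "\<phi> \<in> dual_ball (4 * L * (\<Sum>j. w j * P j \<phi>))"
    using dual_ball_linear[OF \<phi>] by (simp add: dual_ball_def)
  show "(\<Sum>j. w j * P j (\<lambda>y. c * \<phi> y)) = \<bar>c\<bar> * (\<Sum>j. w j * P j \<phi>)" for c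
    by (simp add: dual_gaugeD(4)[OF g D \<phi>] mult.left_commute suminf_mult[OF sm])
  fix \<eta> :: real assume "0 < \<eta>"
  then have "0 < \<eta> / 2" by simp
  moreover have "\<forall>\<^sub>F \<psi> in nhds \<phi>. \<psi> \<in> dual_ball D \<longrightarrow> P 0 \<phi> - \<eta> / 2 < P 0 \<psi>"
    by (rule dual_gaugeD(5)[OF g D \<phi>]) fact
  moreover note mixture_lower_bound[OF g w0 w1 D \<phi>, where k = 0 and \<eta> = "\<eta> / 2"]
  moreover have "w 0 \<le> 1" using w0 w1 sum_le_suminf[of w "{0}"] by (auto simp: sums_iff)
  ultimately show "\<forall>\<^sub>F \<psi> in nhds \<phi>. \<psi> \<in> dual_ball D \<longrightarrow> (\<Sum>j. w j * P j \<phi>) - \<eta> < (\<Sum>j. w j * P j \<psi>)"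
  proof (elim eventually_elim2[rotated], intro impI)
    fix \<psi> assume 1: "\<psi> \<in> dual_ball D \<longrightarrow> P 0 \<phi> - \<eta> / 2 < P 0 \<psi>"
      "\<psi> \<in> dual_ball D \<longrightarrow> (\<Sum>j. w j * P j \<phi>) + w 0 * (P 0 \<psi> - P 0 \<phi>) - \<eta> / 2 < (\<Sum>j. w j * P j \<psi>)"
      and \<psi>: "\<psi> \<in> dual_ball D" and w: "w 0 \<le> 1"
    have "- (\<eta> / 2) \<le> w 0 * - (\<eta> / 2)" using w \<open>0 < \<eta>\<close> w0[of 0] by (simp add: mult_left_le_one_le)
    also have "\<dots> \<le> w 0 * (P 0 \<psi> - P 0 \<phi>)" using 1 \<psi> w0[of 0] by (intro mult_left_mono) auto
    finally show "(\<Sum>j. w j * P j \<phi>) - \<eta> < (\<Sum>j. w j * P j \<psi>)" using 1 \<psi> by auto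
  qed
qed

section \<open>One gauge for each level of smoothness\<close>

context coarse_lipschitz_pair
begin

lemma dual_gauge_slope:
  assumes \<theta>: "1 \<le> \<theta>" and t: "1 \<le> t" "L * \<theta> + L + 2 * \<omega> \<le> t" "4 * \<omega> \<le> t" and r: "norm (G 0) + L * t + L \<le> r"
    and FG: "\<And>v. norm v \<le> t \<Longrightarrow> norm (F (G v) - v) \<le> \<omega>" and nontriv: "(y0 :: 'b) \<noteq> 0"
  shows "pairs \<theta> r \<noteq> ({} :: ('a \<times> 'a) set)" "dual_gauge L (slope F \<theta> r)"
proof -
  note lower = slope_lower[OF \<theta> t(1,2) r FG]
  have "norm ((1 / norm y0) *\<^sub>R y0) = 1" using nontriv by simp
  from lower(1)[OF _ this] show ne: "pairs \<theta> r \<noteq> ({} :: ('a \<times> 'a) set)" by blast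
  show "dual_gauge L (slope F \<theta> r)"
    unfolding dual_gauge_def
  proof (intro allI impI ballI conjI)
    fix D :: real and \<phi> :: "'b \<Rightarrow> real" assume D: "0 \<le> D" and \<phi>: "\<phi> \<in> dual_ball D"
    let ?s = "slope F \<theta> r \<phi>"
    show s0: "0 \<le> ?s" by (rule F.slope_nonneg[OF \<theta> \<phi> ne])
    show "?s \<le> 2 * L * D" by (rule F.slope_le[OF \<theta> D \<phi> ne])
    show "slope F \<theta> r (\<lambda>y. c * \<phi> y) = \<bar>c\<bar> * ?s" for c by (rule F.slope_mult[OF \<theta> \<phi> ne])
    show "\<forall>\<^sub>F \<psi> in nhds \<phi>. \<psi> \<in> dual_ball D \<longrightarrow> ?s - \<eta> < slope F \<theta> r \<psi>" if "0 < \<eta>" for \<eta>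
      by (rule F.slope_lsc[OF \<theta> \<phi> ne that])
    have bl: "bounded_linear \<phi>"
      using dual_ball_linear[OF \<phi>] dual_ball_abs_le[OF \<phi>]
      by (intro bounded_linear_intro[of \<phi> D]) (auto simp: linear_iff mult.commute)
    \<comment> \<open>With the exact norm \<open>K\<close> of \<open>\<phi>\<close> the error of the
      lower estimate is at most \<open>K / 2\<close> and is absorbed into the left side; this is the
      origin of the factor \<open>4 * L\<close>.\<close>
    define K where "K = onorm \<phi>"
    have \<phi>K: "\<phi> \<in> dual_ball K"
      using onorm[OF bl] dual_ball_linear[OF \<phi>] by (simp add: dual_ball_def K_def)
    have K0: "0 \<le> K" unfolding K_def by (rule onorm_pos_le[OF bl])
    have unit: "\<phi> y \<le> 2 * L * ?s + K / 2" if "norm y = 1" for y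
    proof -
      have "2 * \<omega> / t \<le> 1 / 2" using t by (simp add: divide_simps)
      then have "2 * \<omega> / t * K \<le> 1 / 2 * K" using K0 by (rule mult_right_mono)
      then show ?thesis using lower(2)[OF _ that \<phi>K s0] by simp
    qed
    have "norm (\<phi> y) \<le> (2 * L * ?s + K / 2) * norm y" for y
    proof (cases "y = 0")
      case True
      then show ?thesis using linear_0[OF dual_ball_linear[OF \<phi>]] by simp
    next
      case False
      define v where "v = (1 / norm y) *\<^sub>R y"
      have v: "norm v = 1" "norm (- v) = 1" using False by (simp_all add: v_def)
      have "\<phi> (- v) = - \<phi> v" by (rule linear_neg[OF dual_ball_linear[OF \<phi>]])
      then have "\<bar>\<phi> v\<bar> \<le> 2 * L * ?s + K / 2" using unit[OF v(1)] unit[OF v(2)] by linarith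
      moreover have "\<phi> v = \<phi> y / norm y" by (simp add: v_def dual_ball_scaleR[OF \<phi>])
      ultimately show ?thesis using False by (simp add: pos_divide_le_eq)
    qed
    moreover have "0 \<le> 2 * L * ?s + K / 2" using F.L s0 K0 by simp
    ultimately have "onorm \<phi> \<le> 2 * L * ?s + K / 2" by (intro onorm_bound)
    then have "K \<le> 2 * L * ?s + K / 2" by (simp only: K_def)
    then show "\<phi> \<in> dual_ball (4 * L * ?s)" by (intro dual_ball_mono[OF \<phi>K]) simp
  qed
qed

text \<open>The number \<open>N\<close> of scales comes from \<open>\<delta>\<close>, and with it
  the range of all distances and radii as multiples of \<open>R\<close>. Then
  \<open>\<epsilon>\<close> is fixed, and \<open>R\<close> last, so large that additive constants
  are negligible and closeness errors are at most \<open>\<epsilon> * R\<close> on the whole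
  range.\<close>

lemma level_gauge:
  assumes GF: "\<And>\<epsilon> K. 0 < \<epsilon> \<Longrightarrow> 0 < K \<Longrightarrow> \<forall>\<^sub>F R in at_top. \<forall>x. norm x \<le> K * R \<longrightarrow> norm (G (F x) - x) \<le> \<epsilon> * R"
    and FG: "\<And>\<epsilon> K. 0 < \<epsilon> \<Longrightarrow> 0 < K \<Longrightarrow> \<forall>\<^sub>F R in at_top. \<forall>x. norm x \<le> K * R \<longrightarrow> norm (F (G x) - x) \<le> \<epsilon> * R"
    and nontriv: "(y0 :: 'b) \<noteq> 0" and \<tau>: "0 < \<tau>" "\<tau> \<le> 1 / 2" and \<delta>: "0 < \<delta>" and D: "0 \<le> D"
    and smooth: "\<And>x :: 'a. norm x = 1 \<Longrightarrow> \<exists>E\<in>cof. \<forall>e\<in>E. norm e \<le> \<tau> \<longrightarrow> norm (x + e) \<le> 1 + \<delta>"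
  obtains P :: "('b \<Rightarrow> real) \<Rightarrow> real" where "dual_gauge L P"
    "\<And>\<phi>. \<phi> \<in> dual_ball D \<Longrightarrow> \<forall>\<^sub>F \<psi> in nhds \<phi>. \<psi> \<in> dual_ball D \<longrightarrow> (\<forall>z. norm z \<le> 1 \<longrightarrow>
      P \<phi> + \<tau> / (4 * L) * (\<psi> z - \<phi> z) - (3 + 8 * L * D) * \<delta> \<le> P \<psi>)"
proof -
  have L: "1 \<le> L" by (rule F.L)
  obtain N :: nat where N: "1 / \<delta> < real N" using reals_Archimedean2 by blast
  have N0: "0 < N" using N \<delta> by (metis divide_pos_pos less_trans of_nat_0_less_iff zero_less_one)
  have N\<delta>: "1 / real N \<le> \<delta>" using N \<delta> N0 by (simp add: divide_simps mult.commute)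
  define M :: real where "M = 4 ^ N"
  define \<rho> where "\<rho> = 1 + L * (L * M + L + 2) + L"
  define B where "B = \<rho> * 2 ^ N"
  \<comment> \<open>The three bounds serve the gauge property and the hypotheses \<open>i\<close>
    and \<open>ii\<close> of \<open>slope_gain\<close>; the summand \<open>1\<close> covers
    \<open>D = 0\<close>.\<close>
  define \<epsilon> where "\<epsilon> = min (1 / 4) (min (\<tau> / 4) (\<delta> / (2 * D + 1)))"
  have M: "1 \<le> M" by (simp add: M_def)
  have LM: "0 \<le> L * M" using L M by simp
  have LLM: "0 \<le> L * (L * M + L + 2)" using L LM by simp
  have \<rho>: "1 \<le> \<rho>" using LLM L by (simp add: \<rho>_def)
  have \<rho>B: "\<rho> \<le> B" unfolding B_def using \<rho> by simp
  have \<epsilon>: "0 < \<epsilon>" using \<tau> \<delta> D by (simp add: \<epsilon>_def)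
  have \<epsilon>_le: "\<epsilon> \<le> 1 / 4" "\<epsilon> \<le> \<tau> / 4" "\<epsilon> \<le> \<delta> / (2 * D + 1)"
    unfolding \<epsilon>_def by (simp_all only: min.cobounded1 min.coboundedI2 min.cobounded2)
  have D\<epsilon>: "2 * D * \<epsilon> \<le> \<delta>"
  proof -
    have "2 * D * \<epsilon> \<le> (2 * D + 1) * \<epsilon>" using \<epsilon> by simp
    also have "\<dots> \<le> \<delta>" using \<epsilon>_le(3) D by (simp add: pos_le_divide_eq mult.commute)
    finally show ?thesis .
  qed
  define B' where "B' = L * B + L + 1 + B"
  have LB: "0 \<le> L * B" using L \<rho> \<rho>B by simp
  have B: "0 < B" "0 < B'" using \<rho> \<rho>B L LB unfolding B'_def by linarith+
  have "\<forall>\<^sub>F R in at_top. 1 \<le> R \<and> norm (F 0) \<le> R \<and> norm (G 0) \<le> R \<and>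
      (2 * L ^ 2 + 3 * L + 1) * 2 / \<tau> \<le> R \<and> (2 * D * (L * (2 * L ^ 2 + L + 2)) + 1) / \<delta> \<le> R \<and>
      (\<forall>x. norm x \<le> B * R \<longrightarrow> norm (G (F x) - x) \<le> \<epsilon> * R) \<and>
      (\<forall>x. norm x \<le> B' * R \<longrightarrow> norm (F (G x) - x) \<le> \<epsilon> * R)"
    by (intro eventually_conj eventually_ge_at_top GF[OF \<epsilon> B(1)] FG[OF \<epsilon> B(2)])
  then obtain R where R: "1 \<le> R" "norm (F 0) \<le> R" "norm (G 0) \<le> R" "(2 * L ^ 2 + 3 * L + 1) * 2 / \<tau> \<le> R"
      "(2 * D * (L * (2 * L ^ 2 + L + 2)) + 1) / \<delta> \<le> R"
    and GFR: "\<And>x. norm x \<le> B * R \<Longrightarrow> norm (G (F x) - x) \<le> \<epsilon> * R"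
    and FGR: "\<And>x. norm x \<le> B' * R \<Longrightarrow> norm (F (G x) - x) \<le> \<epsilon> * R"
    by (auto dest!: eventually_happens)
  \<comment> \<open>A midpoint step divides the distance by \<open>4\<close> and doubles the radius,
    so distances increase and radii decrease with \<open>k\<close>.\<close>
  define \<theta> where "\<theta> k = R * 4 ^ k" for k :: nat
  define r where "r k = R * (\<rho> * 2 ^ (N - k))" for k
  define t where "t = R * (L * M + L + 2)"
  have \<theta>1: "1 \<le> \<theta> k" for k
    using R(1) mult_mono[of 1 R 1 "4 ^ k"] by (simp add: \<theta>_def)
  have tR: "R \<le> t" unfolding t_def using R(1) L LM by simp
  have \<epsilon>R: "\<epsilon> * R \<le> 1 / 4 * R" using \<epsilon>_le(1) R(1) by (intro mult_right_mono) auto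
  have "t \<le> B' * R"
  proof -
    define q where "q = L * M + L + 2"
    have "1 * q \<le> L * q" using L LM unfolding q_def by (intro mult_right_mono) auto
    moreover have "1 + L * q + L \<le> B" using \<rho>B by (simp add: \<rho>_def q_def)
    ultimately have "q \<le> B'" unfolding B'_def using L LB by linarith
    then have "L * M + L + 2 \<le> B'" by (simp add: q_def)
    then show ?thesis unfolding t_def using R(1) by (simp add: mult.commute)
  qed
  then have FGt: "norm (F (G v) - v) \<le> \<epsilon> * R" if "norm v \<le> t" for v
    using FGR that order_trans by blast
  have gauge: "pairs (\<theta> k) (r k) \<noteq> ({} :: ('a \<times> 'a) set)" "dual_gauge L (slope F (\<theta> k) (r k))" if k: "k \<le> N" for k
  proof -
    have "L * \<theta> k \<le> R * (L * M)"
      unfolding \<theta>_def M_def using k L R(1) by (simp add: power_increasing mult_left_mono)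
    moreover have "L \<le> L * R" using L R(1) by simp
    ultimately have c1: "L * \<theta> k + L + 2 * (\<epsilon> * R) \<le> t"
    proof -
      have "t = R * (L * M) + L * R + 2 * R" by (simp add: t_def algebra_simps)
      then show ?thesis using \<epsilon>R R(1) \<open>L * \<theta> k \<le> R * (L * M)\<close> \<open>L \<le> L * R\<close> by linarith
    qed
    have "norm (G 0) + L * t + L \<le> R + L * t + L * R" using R(3) \<open>L \<le> L * R\<close> by simp
    also have "\<dots> = R * \<rho>" by (simp add: t_def \<rho>_def algebra_simps)
    also have "\<dots> \<le> r k" unfolding r_def using R(1) \<rho> by (intro mult_left_mono) auto
    finally have c2: "norm (G 0) + L * t + L \<le> r k" .
    have c0: "1 \<le> t" "4 * (\<epsilon> * R) \<le> t" using tR R(1) \<epsilon>R by linarith+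
    show "pairs (\<theta> k) (r k) \<noteq> ({} :: ('a \<times> 'a) set)" "dual_gauge L (slope F (\<theta> k) (r k))"
      by (rule dual_gauge_slope[OF \<theta>1 c0(1) c1 c0(2) c2 FGt nontriv], assumption)+
  qed
  \<comment> \<open>Mixtures are indexed by all naturals; indices above \<open>N\<close> repeat the
    last gauge and get weight \<open>0\<close>.\<close>
  define s where "s k = slope F (\<theta> (min k N)) (r (min k N))" for k
  have s: "dual_gauge L (s k)" for k using gauge(2)[of "min k N"] by (simp add: s_def)
  define w where "w k = (if k < N then 1 / real N else 0)" for k
  have "w sums (\<Sum>k\<in>{..<N}. w k)" by (rule sums_finite) (auto simp: w_def)
  then have w1: "w sums 1" using N0 by (simp add: w_def)
  define P where "P \<phi> = (\<Sum>k. w k * s k \<phi>)" for \<phi>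
  have P: "P \<phi> = (\<Sum>k<N. s k \<phi>) / real N" for \<phi>
  proof -
    have "P \<phi> = (\<Sum>k\<in>{..<N}. w k * s k \<phi>)" unfolding P_def by (rule suminf_finite) (auto simp: w_def)
    also have "\<dots> = (\<Sum>k<N. s k \<phi>) / real N" by (simp add: w_def sum_divide_distrib)
    finally show ?thesis .
  qed
  show thesis
  proof (rule that[of P])
    have "0 \<le> w k" for k by (simp add: w_def)
    then have "dual_gauge L (\<lambda>\<phi>. \<Sum>k. w k * s k \<phi>)"
      using L by (intro dual_gauge_mixture[OF _ s _ w1]) auto
    moreover have "P = (\<lambda>\<phi>. \<Sum>k. w k * s k \<phi>)" by (simp add: P_def fun_eq_iff)
    ultimately show "dual_gauge L P" by simp
    fix \<phi> :: "'b \<Rightarrow> real" assume \<phi>: "\<phi> \<in> dual_ball D"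
    let ?c = "\<tau> / (4 * L)"
    have gain: "\<forall>\<^sub>F \<psi> in nhds \<phi>. \<psi> \<in> dual_ball D \<longrightarrow> (\<forall>z. norm z \<le> 1 \<longrightarrow>
        2 * s (Suc k) \<phi> - s k \<phi> + ?c * (\<psi> z - \<phi> z) - (3 + 4 * L * D) * \<delta> \<le> s k \<psi>)" if k: "k < N" for k
    proof -
      have r2: "2 * r (Suc k) = r k" using k Suc_diff_Suc[OF k] by (simp add: r_def mult_ac flip: power_Suc)
      have rB: "r k \<le> B * R" unfolding r_def B_def using R(1) \<rho> by (simp add: mult_ac power_increasing)
      have r0: "0 \<le> r (Suc k)" unfolding r_def using R(1) \<rho> by simp
      have \<theta>R: "4 * R \<le> \<theta> (Suc k)" unfolding \<theta>_def using R(1) by simp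
      have i: "2 * (L + \<epsilon> * R) + 2 * L ^ 2 + L + 1 \<le> \<tau> * \<theta> (Suc k) / 4"
      proof -
        have "(2 * L ^ 2 + 3 * L + 1) * 2 \<le> R * \<tau>" using R(4) \<tau> by (simp add: pos_divide_le_eq)
        moreover have "\<epsilon> * R \<le> \<tau> / 4 * R" using \<epsilon>_le(2) R(1) by (intro mult_right_mono) auto
        moreover have "\<tau> * (4 * R) \<le> \<tau> * \<theta> (Suc k)" using \<tau> \<theta>R by (intro mult_left_mono) auto
        ultimately show ?thesis by (simp add: algebra_simps)
      qed
      have ii: "2 * D * (L * (2 * L ^ 2 + L + 2) + \<epsilon> * R) + 1 \<le> \<delta> * \<theta> (Suc k) / 2"
      proof -
        define q where "q = L * (2 * L ^ 2 + L + 2)"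
        have "2 * D * q + 1 \<le> \<delta> * R" using R(5) \<delta> by (simp add: q_def pos_divide_le_eq mult.commute)
        moreover have "2 * D * \<epsilon> * R \<le> \<delta> * R" using D\<epsilon> R(1) by (intro mult_right_mono) auto
        moreover have "\<delta> * (4 * R) \<le> \<delta> * \<theta> (Suc k)" using \<delta> \<theta>R by (intro mult_left_mono) auto
        moreover have "2 * D * (q + \<epsilon> * R) = 2 * D * q + 2 * D * \<epsilon> * R" by (simp add: algebra_simps)
        ultimately show ?thesis unfolding q_def[symmetric] by linarith
      qed
      have GF': "norm (G (F x) - x) \<le> \<epsilon> * R" if "norm x \<le> 2 * r (Suc k)" for x
        using that rB r2 by (intro GFR) simp
      have FG': "norm (F (G v) - v) \<le> \<epsilon> * R"
        if "norm v \<le> norm (F 0) + L * (2 * r (Suc k)) + L + r (Suc k)" for v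
      proof (rule FGR)
        have "L * (2 * r (Suc k)) \<le> L * (B * R)" using r2 rB L by simp
        moreover have "L \<le> L * R" using L R(1) by simp
        moreover have "r (Suc k) \<le> B * R" using r2 rB r0 by linarith
        ultimately show "norm v \<le> B' * R" using that R(2) by (simp add: B'_def algebra_simps)
      qed
      have sk: "s (Suc k) = slope F (\<theta> (Suc k)) (r (Suc k))" "s k = slope F (\<theta> k) (2 * r (Suc k))"
        using k by (simp_all add: s_def min_def r2)
      show ?thesis
        unfolding sk
        using \<epsilon> R(1) k
        by (intro slope_gain[OF \<tau> \<delta> smooth D \<phi> \<theta>1 _ _ GF' FG' i ii gauge(1)]) (auto simp: \<theta>_def)
    qed
    have "\<forall>\<^sub>F \<psi> in nhds \<phi>. \<forall>k\<in>{..<N}. \<psi> \<in> dual_ball D \<longrightarrow> (\<forall>z. norm z \<le> 1 \<longrightarrow>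
        2 * s (Suc k) \<phi> - s k \<phi> + ?c * (\<psi> z - \<phi> z) - (3 + 4 * L * D) * \<delta> \<le> s k \<psi>)"
      using gain by (intro eventually_ball_finite) auto
    then show "\<forall>\<^sub>F \<psi> in nhds \<phi>. \<psi> \<in> dual_ball D \<longrightarrow> (\<forall>z. norm z \<le> 1 \<longrightarrow>
      P \<phi> + ?c * (\<psi> z - \<phi> z) - (3 + 8 * L * D) * \<delta> \<le> P \<psi>)"
    proof eventually_elim
      case (elim \<psi>)
      show ?case
      proof (intro impI allI)
        fix z :: 'b assume \<psi>: "\<psi> \<in> dual_ball D" and z: "norm z \<le> 1"
        define g where "g = ?c * (\<psi> z - \<phi> z) - (3 + 4 * L * D) * \<delta>"
        \<comment> \<open>The boundary term \<open>2 * (s N \<phi> - s 0 \<phi>)\<close> is at least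
          \<open>- 4 * (L * D)\<close> by the bounds of a gauge alone, without comparing slopes at
          different scales; after division by \<open>N\<close> it costs at most
          \<open>4 * L * D * \<delta>\<close>.\<close>
        have tel: "(\<Sum>k<n. 2 * s (Suc k) \<phi> - s k \<phi>) = (\<Sum>k<n. s k \<phi>) + 2 * s n \<phi> - 2 * s 0 \<phi>" for n
          by (induction n) auto
        have "(\<Sum>k<N. 2 * s (Suc k) \<phi> - s k \<phi> + g) \<le> (\<Sum>k<N. s k \<psi>)"
        proof (rule sum_mono)
          fix k assume "k \<in> {..<N}"
          with elim \<psi> z have "2 * s (Suc k) \<phi> - s k \<phi> + ?c * (\<psi> z - \<phi> z) - (3 + 4 * L * D) * \<delta> \<le> s k \<psi>"
            by blast
          then show "2 * s (Suc k) \<phi> - s k \<phi> + g \<le> s k \<psi>" unfolding g_def by linarith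
        qed
        then have "(\<Sum>k<N. s k \<phi>) + 2 * s N \<phi> - 2 * s 0 \<phi> + real N * g \<le> (\<Sum>k<N. s k \<psi>)"
          unfolding sum.distrib tel by simp
        moreover have "- (2 * (L * D)) \<le> s N \<phi> - s 0 \<phi>"
          using dual_gaugeD(1)[OF s D \<phi>, of N] dual_gaugeD(2)[OF s D \<phi>, of 0, unfolded mult.assoc] by linarith
        ultimately have "(\<Sum>k<N. s k \<phi>) - 4 * (L * D) + real N * g \<le> (\<Sum>k<N. s k \<psi>)" by linarith
        then have "((\<Sum>k<N. s k \<phi>) - 4 * (L * D) + real N * g) / real N \<le> P \<psi>"
          unfolding P by (rule divide_right_mono) simp
        moreover have "((\<Sum>k<N. s k \<phi>) - 4 * (L * D) + real N * g) / real N = P \<phi> - 4 * (L * D) * (1 / real N) + g"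
          using N0 by (simp add: P field_simps)
        moreover have "4 * (L * D) * (1 / real N) \<le> 4 * (L * D) * \<delta>"
          using N\<delta> L D by (intro mult_left_mono) auto
        ultimately have "P \<phi> - 4 * (L * D) * \<delta> + g \<le> P \<psi>" by linarith
        then show "P \<phi> + ?c * (\<psi> z - \<phi> z) - (3 + 8 * L * D) * \<delta> \<le> P \<psi>"
          by (simp add: g_def algebra_simps)
      qed
    qed
  qed
qed

end

section \<open>The predual norm\<close>

text \<open>The polar of the unit ball of the gauge. For a gauge, a value at most \<open>1\<close>
  already bounds the dual norm by \<open>4 * L\<close>, so \<open>dual_ball (4 * L)\<close> holds
  all competitors.\<close>

definition predual_norm :: "real \<Rightarrow> (('b::real_normed_vector \<Rightarrow> real) \<Rightarrow> real) \<Rightarrow> 'b \<Rightarrow> real" where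
  "predual_norm L P y = (SUP \<phi>\<in>{\<phi> \<in> dual_ball (4 * L). P \<phi> \<le> 1}. \<phi> y)"

section \<open>Finite codimensional subspaces cut out by functionals\<close>

lemma cof_Int_kernel:
  assumes Y: "Y \<in> cof" and \<phi>: "\<phi> \<in> dual_ball D"
  shows "Y \<inter> {y. \<phi> y = 0} \<in> cof"
proof -
  obtain F where F: "subspace Y" "closed Y" "finite F" "span (Y \<union> F) = UNIV" using Y by (auto simp: cof_def)
  have "bounded_linear \<phi>"
    using dual_ball_linear[OF \<phi>] dual_ball_abs_le[OF \<phi>]
    by (intro bounded_linear_intro[of \<phi> D]) (auto simp: linear_iff mult.commute)
  then have "closed {y. \<phi> y = 0}"
    by (intro closed_Collect_eq continuous_on_const linear_continuous_on)
  then have 1: "closed (Y \<inter> {y. \<phi> y = 0})" using F(2) by (rule closed_Int[rotated])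
  have 2: "subspace (Y \<inter> {y. \<phi> y = 0})"
    using F(1) linear_0[OF dual_ball_linear[OF \<phi>]]
    by (auto simp: subspace_def dual_ball_add[OF \<phi>] dual_ball_scaleR[OF \<phi>])
  have "\<exists>F. finite F \<and> span (Y \<inter> {y. \<phi> y = 0} \<union> F) = UNIV"
  proof (cases "\<exists>v\<in>Y. \<phi> v \<noteq> 0")
    case True
    then obtain v where v: "v \<in> Y" "\<phi> v \<noteq> 0" by blast
    let ?S = "span (Y \<inter> {y. \<phi> y = 0} \<union> insert v F)"
    have "y \<in> ?S" if y: "y \<in> Y" for y
    proof -
      have "y - (\<phi> y / \<phi> v) *\<^sub>R v \<in> Y" by (intro subspace_diff subspace_scale F(1) y v)
      moreover have "\<phi> (y - (\<phi> y / \<phi> v) *\<^sub>R v) = 0"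
        using v by (simp add: dual_ball_diff[OF \<phi>] dual_ball_scaleR[OF \<phi>])
      ultimately have "y - (\<phi> y / \<phi> v) *\<^sub>R v \<in> ?S" by (intro span_base) auto
      moreover have "(\<phi> y / \<phi> v) *\<^sub>R v \<in> ?S" by (intro span_scale span_base) auto
      ultimately have "y - (\<phi> y / \<phi> v) *\<^sub>R v + (\<phi> y / \<phi> v) *\<^sub>R v \<in> ?S" by (rule span_add)
      then show ?thesis by simp
    qed
    moreover have "F \<subseteq> ?S" by (auto intro: span_base)
    ultimately have "span (Y \<union> F) \<subseteq> ?S" by (intro span_minimal) auto
    then show ?thesis using F by (intro exI[of _ "insert v F"]) auto
  next
    case False
    then have "Y \<inter> {y. \<phi> y = 0} = Y" by blast
    then show ?thesis using F by auto
  qed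
  with 1 2 show ?thesis by (simp add: cof_def)
qed

lemma cof_Inter_kernels:
  assumes "finite T" "T \<subseteq> dual_ball D"
  shows "{y. \<forall>\<phi>\<in>T. \<phi> y = 0} \<in> cof"
  using assms
proof (induction T rule: finite_induct)
  case empty
  then show ?case using UNIV_in_cof by simp
next
  case (insert \<phi> T)
  then have "{y. \<forall>\<phi>\<in>T. \<phi> y = 0} \<inter> {y. \<phi> y = 0} \<in> cof" by (intro cof_Int_kernel) auto
  moreover have "{y. \<forall>\<phi>\<in>insert \<phi> T. \<phi> y = 0} = {y. \<forall>\<phi>\<in>T. \<phi> y = 0} \<inter> {y. \<phi> y = 0}" by auto
  ultimately show ?case by simp
qed

section \<open>The equivalent norm of a gauge and its smoothness\<close>

context
  fixes L :: real and P :: "('b::real_normed_vector \<Rightarrow> real) \<Rightarrow> real"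
  assumes L: "1 \<le> L" and P: "dual_gauge L P"
begin

lemma predual_norm_bdd: "bdd_above ((\<lambda>\<phi>. \<phi> y) ` {\<phi> \<in> dual_ball (4 * L). P \<phi> \<le> 1})"
  by (rule bdd_aboveI2[where M = "4 * L * norm y"]) (use dual_ball_abs_le[of _ "4 * L" y] in \<open>auto simp: abs_le_iff\<close>)

lemma predual_norm_upper: "\<phi> \<in> dual_ball (4 * L) \<Longrightarrow> P \<phi> \<le> 1 \<Longrightarrow> \<phi> y \<le> predual_norm L P y"
  unfolding predual_norm_def by (rule cSUP_upper[OF _ predual_norm_bdd]) simp

lemma zero_in_unit_dual: "(\<lambda>_. 0) \<in> dual_ball D" if "0 \<le> D"
  using that by (simp add: dual_ball_def linear_iff)

lemma predual_norm_least:
  assumes "\<And>\<phi>. \<phi> \<in> dual_ball (4 * L) \<Longrightarrow> P \<phi> \<le> 1 \<Longrightarrow> \<phi> y \<le> c"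
  shows "predual_norm L P y \<le> c"
proof -
  have "P (\<lambda>_. 0) \<le> 2 * L * 0" by (rule dual_gaugeD(2)[OF P order_refl zero_in_unit_dual]) simp
  then have "(\<lambda>_. 0) \<in> {\<phi> \<in> dual_ball (4 * L). P \<phi> \<le> 1}" using zero_in_unit_dual[of "4 * L"] L by simp
  then show ?thesis unfolding predual_norm_def using assms by (intro cSUP_least) auto
qed

text \<open>Follows by homogeneity. It is needed for the centres of neighbourhoods in a covering,
  whose gauge may exceed \<open>1\<close>.\<close>

lemma le_gauge_mult_predual_norm:
  assumes D: "0 \<le> D" and \<phi>: "\<phi> \<in> dual_ball D"
  shows "\<phi> y \<le> P \<phi> * predual_norm L P y"
proof (cases "P \<phi> = 0")
  case True
  then show ?thesis using dual_ball_abs_le[OF dual_gaugeD(3)[OF P D \<phi>], of y] by simp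
next
  case False
  then have p: "0 < P \<phi>" using dual_gaugeD(1)[OF P D \<phi>] by simp
  have "(\<lambda>y. 1 / P \<phi> * \<phi> y) \<in> dual_ball (\<bar>1 / P \<phi>\<bar> * (4 * L * P \<phi>))"
    by (rule dual_ball_mult[OF dual_gaugeD(3)[OF P D \<phi>]])
  then have "(\<lambda>y. 1 / P \<phi> * \<phi> y) \<in> dual_ball (4 * L)" using p by simp
  moreover have "P (\<lambda>y. 1 / P \<phi> * \<phi> y) \<le> 1" using p dual_gaugeD(4)[OF P D \<phi>, of "1 / P \<phi>"] by simp
  ultimately have "1 / P \<phi> * \<phi> y \<le> predual_norm L P y" by (rule predual_norm_upper)
  then show ?thesis using p by (simp add: field_simps)
qed

lemma predual_norm_le: "predual_norm L P y \<le> 4 * L * norm y"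
  by (rule predual_norm_least) (use dual_ball_abs_le[of _ "4 * L" y] in \<open>auto simp: abs_le_iff\<close>)

lemma norm_le_predual_norm: "norm y \<le> 2 * L * predual_norm L P y"
proof -
  obtain \<phi> where \<phi>: "\<phi> \<in> dual_ball 1" "\<phi> y = norm y" using norming_functional by blast
  define c where "c = 1 / (2 * L)"
  have c: "0 < c" "c \<le> 1" "2 * L * c = 1" using L by (simp_all add: c_def)
  have "(\<lambda>y. c * \<phi> y) \<in> dual_ball (4 * L)"
    by (rule dual_ball_mono[OF dual_ball_mult[OF \<phi>(1)]]) (use c L in simp)
  moreover have "P (\<lambda>y. c * \<phi> y) \<le> 1"
  proof -
    have "P (\<lambda>y. c * \<phi> y) = c * P \<phi>" using dual_gaugeD(4)[OF P _ \<phi>(1)] c by simp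
    also have "\<dots> \<le> c * (2 * L * 1)" using c by (intro mult_left_mono dual_gaugeD(2)[OF P _ \<phi>(1)]) auto
    finally show ?thesis using c by (simp add: mult_ac)
  qed
  ultimately have "c * \<phi> y \<le> predual_norm L P y" by (rule predual_norm_upper)
  then have "c * norm y \<le> predual_norm L P y" by (simp only: \<phi>(2))
  then have "2 * L * (c * norm y) \<le> 2 * L * predual_norm L P y" using L by simp
  then show ?thesis using c(3) by (simp flip: mult.assoc)
qed

lemma predual_norm_scaleR: "predual_norm L P (c *\<^sub>R y) = \<bar>c\<bar> * predual_norm L P y"
proof -
  have le: "predual_norm L P (c *\<^sub>R y) \<le> \<bar>c\<bar> * predual_norm L P y" for c y
  proof (rule predual_norm_least)
    fix \<phi> :: "'b \<Rightarrow> real" assume \<phi>: "\<phi> \<in> dual_ball (4 * L)" "P \<phi> \<le> 1"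
    have "(\<lambda>y. (-1) * \<phi> y) \<in> dual_ball (4 * L)" using dual_ball_mult[OF \<phi>(1), of "- 1"] by simp
    moreover have "P (\<lambda>y. (-1) * \<phi> y) \<le> 1" using dual_gaugeD(4)[OF P _ \<phi>(1), of "- 1"] \<phi>(2) L by simp
    ultimately have "(-1) * \<phi> y \<le> predual_norm L P y" by (rule predual_norm_upper)
    then have "- \<phi> y \<le> predual_norm L P y" by simp
    then have "\<bar>\<phi> y\<bar> \<le> predual_norm L P y" using predual_norm_upper[OF \<phi>, of y] by simp
    then have "\<bar>c\<bar> * \<bar>\<phi> y\<bar> \<le> \<bar>c\<bar> * predual_norm L P y" by (rule mult_left_mono) simp
    then show "\<phi> (c *\<^sub>R y) \<le> \<bar>c\<bar> * predual_norm L P y"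
      unfolding dual_ball_scaleR[OF \<phi>(1)] by (simp flip: abs_mult)
  qed
  show ?thesis
  proof (cases "c = 0")
    case True
    have "0 \<le> predual_norm L P 0" using norm_le_predual_norm[of 0] L by (simp add: zero_le_mult_iff)
    then show ?thesis using le[of 0 y] True by simp
  next
    case False
    have "\<bar>c\<bar> * predual_norm L P y \<le> predual_norm L P (c *\<^sub>R y)"
      using le[of "1 / c" "c *\<^sub>R y"] False by (simp add: field_simps)
    with le[of c y] show ?thesis by simp
  qed
qed

lemma predual_norm_triangle: "predual_norm L P (x + y) \<le> predual_norm L P x + predual_norm L P y"
  by (rule predual_norm_least) (auto simp: dual_ball_add intro!: add_mono predual_norm_upper)

lemma equivalent_norm_predual_norm: "equivalent_norm (predual_norm L P)"
  unfolding equivalent_norm_def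
proof (intro conjI allI predual_norm_triangle predual_norm_scaleR)
  fix x :: 'b
  show "predual_norm L P x = 0 \<longleftrightarrow> x = 0"
    using norm_le_predual_norm[of x] predual_norm_scaleR[of 0 x] by auto
  show "\<exists>a>0. \<exists>b>0. \<forall>x. a * norm x \<le> predual_norm L P x \<and> predual_norm L P x \<le> b * norm x"
  proof (rule exI[of _ "1 / (2 * L)"], intro conjI exI[of _ "4 * L"] allI predual_norm_le)
    show "1 / (2 * L) * norm x \<le> predual_norm L P x" for x
      using norm_le_predual_norm[of x] L by (simp add: field_simps)
  qed (use L in auto)
qed

text \<open>By compactness finitely many centres \<open>\<phi>\<close> suffice, and \<open>z\<close>
  is taken in their common kernel. For \<open>\<psi>\<close> near \<open>\<phi>\<close> the gain
  then bounds \<open>P \<phi> + \<tau> * \<psi> z\<close> by \<open>1 + b\<close>, while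
  \<open>\<psi> x\<close> is at most \<open>\<phi> x + \<eta>\<close> and \<open>\<phi> x\<close> at
  most \<open>P \<phi>\<close>; adding these gives the claim.\<close>

lemma predual_norm_modulus:
  assumes gain: "\<And>\<phi>. \<phi> \<in> dual_ball (4 * L) \<Longrightarrow> \<forall>\<^sub>F \<psi> in nhds \<phi>. \<psi> \<in> dual_ball (4 * L) \<longrightarrow> (\<forall>z. norm z \<le> 1 \<longrightarrow>
      P \<phi> + \<kappa> * (\<psi> z - \<phi> z) - b \<le> P \<psi>)"
    and \<tau>: "0 \<le> \<tau>" "2 * L * \<tau> \<le> \<kappa>" and \<eta>: "0 < \<eta>" and x: "predual_norm L P x = 1"
  shows "\<exists>Z\<in>cof. \<forall>z\<in>Z. predual_norm L P z = 1 \<longrightarrow> predual_norm L P (x + \<tau> *\<^sub>R z) \<le> 1 + b + \<eta>"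
proof -
  let ?B = "dual_ball (4 * L) :: ('b \<Rightarrow> real) set"
  define Q where "Q \<phi> \<psi> \<longleftrightarrow> \<psi> \<in> ?B \<longrightarrow> (\<forall>z. norm z \<le> 1 \<longrightarrow> P \<phi> + \<kappa> * (\<psi> z - \<phi> z) - b \<le> P \<psi>) \<and> \<psi> x \<le> \<phi> x + \<eta>" for \<phi> \<psi>
  have "\<forall>\<^sub>F \<psi> in nhds \<phi>. Q \<phi> \<psi>" if "\<phi> \<in> ?B" for \<phi>
    using gain[OF that] eventually_nhds_fun_close[OF \<eta>, of x \<phi>]
    by eventually_elim (auto simp: Q_def)
  then have "\<exists>U. open U \<and> \<phi> \<in> U \<and> (\<forall>\<psi>\<in>U. Q \<phi> \<psi>)" if "\<phi> \<in> ?B" for \<phi>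
    using that unfolding eventually_nhds by blast
  then obtain U where U: "\<And>\<phi>. \<phi> \<in> ?B \<Longrightarrow> open (U \<phi>) \<and> \<phi> \<in> U \<phi> \<and> (\<forall>\<psi>\<in>U \<phi>. Q \<phi> \<psi>)" by metis
  have "?B \<subseteq> (\<Union>\<phi>\<in>?B. U \<phi>)" using U by blast
  then obtain T where T: "T \<subseteq> ?B" "finite T" "?B \<subseteq> (\<Union>\<phi>\<in>T. U \<phi>)"
    using compactE_image[OF compact_dual_ball, of ?B U] U by blast
  show ?thesis
  proof (intro bexI[OF _ cof_Inter_kernels[OF T(2,1)]] ballI impI predual_norm_least)
    fix z \<psi> assume z: "z \<in> {y. \<forall>\<phi>\<in>T. \<phi> y = 0}" "predual_norm L P z = 1" and \<psi>: "\<psi> \<in> ?B" "P \<psi> \<le> 1"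
    obtain \<phi> where \<phi>: "\<phi> \<in> T" "\<psi> \<in> U \<phi>" using T(3) \<psi>(1) by blast
    have \<phi>B: "\<phi> \<in> ?B" using \<phi> T by blast
    then have q: "P \<phi> + \<kappa> * (\<psi> z - \<phi> z) - b \<le> P \<psi>" if "norm z \<le> 1" for z
      using U \<phi>(2) \<psi>(1) that unfolding Q_def by blast
    have q2: "\<psi> x \<le> \<phi> x + \<eta>" using U[OF \<phi>B] \<phi>(2) \<psi>(1) unfolding Q_def by blast
    have "\<phi> z = 0" using z(1) \<phi>(1) by simp
    \<comment> \<open>The gain is stated for the original unit ball, while \<open>z\<close> is a
      unit vector of the new norm; this is the factor \<open>2 * L\<close> in the hypothesis on
      \<open>\<tau>\<close>.\<close>
    have "norm ((1 / (2 * L)) *\<^sub>R z) \<le> 1"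
      using norm_le_predual_norm[of z] z(2) L by (simp add: divide_simps)
    from q[OF this] have q3: "P \<phi> + \<kappa> * (\<psi> z / (2 * L)) - b \<le> 1"
      using \<psi>(2) \<open>\<phi> z = 0\<close> by (simp add: dual_ball_scaleR[OF \<psi>(1)] dual_ball_scaleR[OF \<phi>B])
    have q0: "P \<phi> - b \<le> 1" using q[of 0] \<psi>(2) linear_0[OF dual_ball_linear[OF \<psi>(1)]] linear_0[OF dual_ball_linear[OF \<phi>B]]
      by simp
    have "P \<phi> + \<tau> * \<psi> z - b \<le> 1"
    proof (cases "0 \<le> \<psi> z")
      case True
      have "2 * L * \<tau> * (\<psi> z / (2 * L)) \<le> \<kappa> * (\<psi> z / (2 * L))"
        using True L by (intro mult_right_mono \<tau>) auto
      then show ?thesis using q3 L by simp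
    next
      case False
      then have "\<tau> * \<psi> z \<le> 0" using \<tau> by (simp add: mult_nonneg_nonpos)
      then show ?thesis using q0 by simp
    qed
    moreover have "\<phi> x \<le> P \<phi>" using le_gauge_mult_predual_norm[OF _ \<phi>B, of x] x L by simp
    ultimately show "\<psi> (x + \<tau> *\<^sub>R z) \<le> 1 + b + \<eta>"
      using q2 by (simp add: dual_ball_add[OF \<psi>(1)] dual_ball_scaleR[OF \<psi>(1)])
  qed
qed

end

text \<open>In infinite dimension all spheres are nonempty, so the inner suprema are nonnegative,
  the infimum over \<open>cof\<close> is bounded below, and a single subspace bounds it from
  above.\<close>

lemma aus_modulus_le:
  fixes N :: "'b::real_normed_vector \<Rightarrow> real"
  assumes N: "equivalent_norm N" and inf: "\<not> finite_dim_space TYPE('b)"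
    and le: "\<And>x. N x = 1 \<Longrightarrow> \<exists>Z\<in>cof. \<forall>z\<in>Z. N z = 1 \<longrightarrow> N (x + \<tau> *\<^sub>R z) \<le> 1 + b"
  shows "aus_modulus N \<tau> \<le> b"
proof -
  have Nz: "N x = 0 \<longleftrightarrow> x = 0" and Nt: "N (x + y) \<le> N x + N y" and Ns: "N (c *\<^sub>R x) = \<bar>c\<bar> * N x" for x y c
    using N by (auto simp: equivalent_norm_def)
  have N0: "0 \<le> N x" for x
    using Nt[of x "- x"] Ns[of "- 1" x] Nz[of 0] by simp
  have ne: "unit_sphere_on N Y \<noteq> {}" if Y: "Y \<in> cof" for Y
  proof -
    obtain F where F: "subspace Y" "finite F" "span (Y \<union> F) = UNIV" using Y by (auto simp: cof_def)
    have "Y \<noteq> {0}"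
    proof
      assume "Y = {0}"
      then have "finite (Y \<union> F)" using F(2) by simp
      then show False using F(3) inf unfolding finite_dim_space_def by blast
    qed
    then obtain y where y: "y \<in> Y" "y \<noteq> 0" using subspace_0[OF F(1)] by blast
    then have "0 < N y" using N0[of y] Nz[of y] by simp
    then have "(1 / N y) *\<^sub>R y \<in> unit_sphere_on N Y"
      using y F(1) by (simp add: unit_sphere_on_def Ns subspace_scale)
    then show ?thesis by blast
  qed
  let ?f = "\<lambda>x Y. SUP y\<in>unit_sphere_on N Y. N (x + \<tau> *\<^sub>R y)"
  have "(INF Y\<in>cof. ?f x Y) \<le> 1 + b" if x: "x \<in> unit_sphere_on N UNIV" for x
  proof -
    obtain Z where Z: "Z \<in> cof" "\<And>z. z \<in> Z \<Longrightarrow> N z = 1 \<Longrightarrow> N (x + \<tau> *\<^sub>R z) \<le> 1 + b"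
      using le[of x] x by (auto simp: unit_sphere_on_def)
    have "0 \<le> ?f x Y" if Y: "Y \<in> cof" for Y
    proof -
      obtain y where y: "y \<in> unit_sphere_on N Y" using ne[OF Y] by blast
      have "N (x + \<tau> *\<^sub>R y) \<le> 1 + \<bar>\<tau>\<bar>" if "y \<in> unit_sphere_on N Y" for y
        using Nt[of x "\<tau> *\<^sub>R y"] that x by (simp add: Ns unit_sphere_on_def)
      then have "N (x + \<tau> *\<^sub>R y) \<le> ?f x Y" by (intro cSUP_upper[OF y] bdd_aboveI2)
      with N0 show ?thesis by (rule order_trans)
    qed
    then have "(INF Y\<in>cof. ?f x Y) \<le> ?f x Z" by (intro cINF_lower[OF _ Z(1)] bdd_belowI2)
    also have "\<dots> \<le> 1 + b" using Z(2) by (intro cSUP_least ne[OF Z(1)]) (auto simp: unit_sphere_on_def)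
    finally show ?thesis .
  qed
  then have "(SUP x\<in>unit_sphere_on N UNIV. INF Y\<in>cof. ?f x Y) \<le> 1 + b"
    by (intro cSUP_least ne[OF UNIV_in_cof])
  then show ?thesis using inf by (simp add: aus_modulus_def)
qed

section \<open>Weights over the levels and the final exponent\<close>

context coarse_lipschitz_pair
begin

lemma equivalent_norm_modulus:
  assumes GF: "\<And>\<epsilon> K. 0 < \<epsilon> \<Longrightarrow> 0 < K \<Longrightarrow> \<forall>\<^sub>F R in at_top. \<forall>x. norm x \<le> K * R \<longrightarrow> norm (G (F x) - x) \<le> \<epsilon> * R"
    and FG: "\<And>\<epsilon> K. 0 < \<epsilon> \<Longrightarrow> 0 < K \<Longrightarrow> \<forall>\<^sub>F R in at_top. \<forall>x. norm x \<le> K * R \<longrightarrow> norm (F (G x) - x) \<le> \<epsilon> * R"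
    and inf: "\<not> finite_dim_space TYPE('b)" and C: "0 < C" and s: "1 < s" "s < q"
    and smooth: "\<And>\<tau> (x :: 'a). 0 < \<tau> \<Longrightarrow> \<tau> < 1 \<Longrightarrow> norm x = 1 \<Longrightarrow>
      \<exists>E\<in>cof. \<forall>e\<in>E. norm e \<le> \<tau> \<longrightarrow> norm (x + e) \<le> 1 + C * \<tau> powr q"
  shows "\<exists>N :: 'b \<Rightarrow> real. equivalent_norm N \<and> (\<exists>C>0. \<forall>\<tau>\<in>{0<..<1}. aus_modulus N \<tau> \<le> C * \<tau> powr s)"
proof -
  have L: "1 \<le> L" by (rule F.L)
  have "span {} \<noteq> (UNIV :: 'b set)"
    using inf unfolding finite_dim_space_def by blast
  then obtain y0 :: 'b where y0: "y0 \<noteq> 0" by auto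
  \<comment> \<open>The solution of \<open>(q + \<epsilon>) / (1 + \<epsilon>) = s\<close>, positive
    because \<open>s\<close> lies between \<open>1\<close> and \<open>q\<close>.\<close>
  define \<epsilon> where "\<epsilon> = (q - s) / (s - 1)"
  have \<epsilon>: "0 < \<epsilon>" using s by (simp add: \<epsilon>_def)
  have \<epsilon>s: "(1 + \<epsilon>) * s = q + \<epsilon>" using s by (simp add: \<epsilon>_def field_simps)
  define \<tau> where "\<tau> k = 2 powr - (1 + real k)" for k
  define a :: real where "a = 2 powr - \<epsilon>"
  define w where "w k = (1 - a) * a ^ k" for k
  \<comment> \<open>The loss factor of \<open>level_gauge\<close> for \<open>D = 4 * L\<close>, the
    ball used by \<open>predual_norm\<close>.\<close>
  define c where "c = 3 + 8 * L * (4 * L)"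
  have c: "0 < c" using L by (simp add: c_def add_pos_nonneg)
  have powr_lt: "2 powr - u < (1 :: real)" if "0 < u" for u :: real
    using powr_less_mono[of "- u" 0 "2 :: real"] that by simp
  have a: "0 < a" "a < 1" using powr_lt[OF \<epsilon>] by (simp_all add: a_def)
  have w0: "0 \<le> w k" for k using a by (simp add: w_def)
  have w1: "w sums 1"
    using sums_mult[OF geometric_sums[of a], of "1 - a"] a by (simp add: w_def[abs_def])
  have \<tau>: "0 < \<tau> k" "\<tau> k \<le> 1 / 2" "\<tau> k < 1" for k
  proof -
    show "0 < \<tau> k" by (simp add: \<tau>_def)
    have "\<tau> k \<le> 2 powr - 1" unfolding \<tau>_def by (intro powr_mono) auto
    then show "\<tau> k \<le> 1 / 2" by (simp add: powr_minus_divide)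
    then show "\<tau> k < 1" by simp
  qed
  have "\<exists>P. dual_gauge L P \<and> (\<forall>\<phi>\<in>dual_ball (4 * L). \<forall>\<^sub>F \<psi> in nhds \<phi>. \<psi> \<in> dual_ball (4 * L) \<longrightarrow> (\<forall>z :: 'b. norm z \<le> 1 \<longrightarrow>
      P \<phi> + \<tau> k / (4 * L) * (\<psi> z - \<phi> z) - c * (C * \<tau> k powr q) \<le> P \<psi>))" for k
    by (rule level_gauge[OF GF FG y0 \<tau>(1) \<tau>(2)[of k] _ _ smooth[OF \<tau>(1,3)[of k]], where D = "4 * L"])
      (use L C \<tau>(1)[of k] in \<open>auto simp: c_def\<close>)
  then have "\<forall>k. \<exists>P. dual_gauge L P \<and> (\<forall>\<phi>\<in>dual_ball (4 * L). \<forall>\<^sub>F \<psi> in nhds \<phi>. \<psi> \<in> dual_ball (4 * L) \<longrightarrow> (\<forall>z :: 'b. norm z \<le> 1 \<longrightarrow>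
      P \<phi> + \<tau> k / (4 * L) * (\<psi> z - \<phi> z) - c * (C * \<tau> k powr q) \<le> P \<psi>))" by blast
  from choice[OF this] obtain P where P: "\<And>k. dual_gauge L (P k)"
    and gain: "\<And>k \<phi>. \<phi> \<in> dual_ball (4 * L) \<Longrightarrow> \<forall>\<^sub>F \<psi> in nhds \<phi>. \<psi> \<in> dual_ball (4 * L) \<longrightarrow> (\<forall>z :: 'b. norm z \<le> 1 \<longrightarrow>
      P k \<phi> + \<tau> k / (4 * L) * (\<psi> z - \<phi> z) - c * (C * \<tau> k powr q) \<le> P k \<psi>)"
    by blast
  define Q where "Q = (\<lambda>\<phi>. \<Sum>k. w k * P k \<phi>)"
  have Q: "dual_gauge L Q" unfolding Q_def using L by (intro dual_gauge_mixture P w0 w1) simp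
  define N where "N = predual_norm L Q"
  have N: "equivalent_norm N" unfolding N_def by (rule equivalent_norm_predual_norm[OF L Q])
  \<comment> \<open>Up to a constant factor, \<open>\<beta> ^ k\<close> is the gain
    \<open>w k * \<tau> k\<close> of level \<open>k\<close>.\<close>
  define \<beta> where "\<beta> = 2 powr - (1 + \<epsilon>)"
  have \<beta>: "0 < \<beta>" "\<beta> < 1" using powr_lt[of "1 + \<epsilon>"] \<epsilon> by (simp_all add: \<beta>_def)
  \<comment> \<open>Chosen so that \<open>A * t \<le> \<beta> ^ k\<close> yields exactly the gain
    that \<open>predual_norm_modulus\<close> demands.\<close>
  define A where "A = 16 * L ^ 2 / (1 - a)"
  have A: "0 < A" using a L by (simp add: A_def)
  define K where "K = c * C * (A / \<beta>) powr s + 2"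
  have K: "0 < K" using c C by (simp add: K_def add_nonneg_pos)
  have pow\<beta>: "\<beta> ^ k = 2 powr (- (1 + \<epsilon>) * real k)" for k
    by (simp add: \<beta>_def powr_powr flip: powr_realpow)
  have powa: "a ^ k = 2 powr (- \<epsilon> * real k)" for k
    by (simp add: a_def powr_powr flip: powr_realpow)
  have small: "\<exists>Z\<in>cof. \<forall>z\<in>Z. N z = 1 \<longrightarrow> N (x + t *\<^sub>R z) \<le> 1 + K * t powr s"
    if t: "0 < t" "A * t \<le> 1" and x: "N x = 1" for t x
  proof -
    have At: "0 < A * t" using A t by simp
    \<comment> \<open>The least such index is positive; its predecessor \<open>k\<close> has
      \<open>\<beta> ^ k\<close> between \<open>A * t\<close> and \<open>A * t / \<beta>\<close>, so
      the gain suffices and the error is still of order \<open>t powr s\<close>.\<close>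
    obtain n where "\<beta> ^ n < A * t" using real_arch_pow_inv[OF At \<beta>(2)] by blast
    then have n: "\<beta> ^ (LEAST n. \<beta> ^ n < A * t) < A * t" by (rule LeastI)
    then have "(LEAST n. \<beta> ^ n < A * t) \<noteq> 0" using t(2) by (metis not_le power_0)
    then obtain k where k: "(LEAST n. \<beta> ^ n < A * t) = Suc k" by (metis not0_implies_Suc)
    have k1: "A * t \<le> \<beta> ^ k" using not_less_Least[of k "\<lambda>n. \<beta> ^ n < A * t"] k by simp
    have k2: "\<beta> ^ k < A * t / \<beta>" using n \<beta> unfolding k by (simp add: pos_less_divide_eq mult.commute)
    have w\<tau>: "w k * \<tau> k = (1 - a) / 2 * \<beta> ^ k"
    proof -
      have "a ^ k * \<tau> k = 2 powr (- 1) * \<beta> ^ k"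
        unfolding powa pow\<beta> \<tau>_def powr_add[symmetric] by (simp add: algebra_simps)
      then show ?thesis by (simp add: w_def powr_minus_divide)
    qed
    have lev: "2 * L * t \<le> w k * \<tau> k / (4 * L)"
    proof -
      have "(1 - a) / 2 * (A * t) \<le> (1 - a) / 2 * \<beta> ^ k" using k1 a by (intro mult_left_mono) auto
      moreover have "(1 - a) / 2 * (A * t) = 8 * L ^ 2 * t" using a by (simp add: A_def)
      ultimately have "8 * L ^ 2 * t \<le> w k * \<tau> k" by (simp only: w\<tau>)
      also have "8 * L ^ 2 * t = 2 * L * t * (4 * L)" by (simp add: power2_eq_square)
      finally show ?thesis using L by (subst pos_le_divide_eq) auto
    qed
    have err: "w k * \<tau> k powr q \<le> (A / \<beta>) powr s * t powr s"
    proof -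
      have "w k * \<tau> k powr q \<le> a ^ k * 2 powr (- q * real k)"
      proof (rule mult_mono)
        show "w k \<le> a ^ k" using a by (simp add: w_def mult_left_le_one_le)
        show "\<tau> k powr q \<le> 2 powr (- q * real k)"
          unfolding \<tau>_def powr_powr using s by (intro powr_mono) (auto simp: algebra_simps)
      qed (use a in auto)
      also have "\<dots> = 2 powr (- (q + \<epsilon>) * real k)" unfolding powa powr_add[symmetric] by (simp add: algebra_simps)
      also have "\<dots> = (\<beta> ^ k) powr s"
        unfolding pow\<beta> powr_powr \<epsilon>s[symmetric] by (simp add: algebra_simps)
      also have "\<dots> \<le> (A * t / \<beta>) powr s" using k2 \<beta> s by (intro powr_mono2) auto
      also have "\<dots> = (A / \<beta>) powr s * t powr s" 
      proof -
        have "A * t / \<beta> = A / \<beta> * t" by simp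
        then show ?thesis using A t \<beta> by (simp only: powr_mult)
      qed
      finally show ?thesis .
    qed
    \<comment> \<open>\<open>\<eta>\<close> is lost twice, in the mixture and in the covering of the
      dual ball; this is the \<open>2\<close> in \<open>K\<close>.\<close>
    define \<eta> where "\<eta> = t powr s"
    have \<eta>: "0 < \<eta>" using t by (simp add: \<eta>_def)
    have "\<forall>\<^sub>F \<psi> in nhds \<phi>. \<psi> \<in> dual_ball (4 * L) \<longrightarrow> (\<forall>z :: 'b. norm z \<le> 1 \<longrightarrow>
        Q \<phi> + w k * \<tau> k / (4 * L) * (\<psi> z - \<phi> z) - (w k * (c * (C * \<tau> k powr q)) + \<eta>) \<le> Q \<psi>)"
      if \<phi>: "\<phi> \<in> dual_ball (4 * L)" for \<phi> :: "'b \<Rightarrow> real"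
    proof -
      have "0 \<le> 4 * L" using L by simp
      from mixture_lower_bound[where P = P and w = w and k = k, OF P w0 w1 this \<phi> \<eta>] gain[OF \<phi>, of k]
      show ?thesis
      proof eventually_elim
        case (elim \<psi>)
        show ?case
        proof (intro impI allI)
          fix z :: 'b assume \<psi>: "\<psi> \<in> dual_ball (4 * L)" and z: "norm z \<le> 1"
          have 1: "Q \<phi> + w k * (P k \<psi> - P k \<phi>) - \<eta> < Q \<psi>" using elim(1) \<psi> by (simp add: Q_def)
          have "\<tau> k / (4 * L) * (\<psi> z - \<phi> z) - c * (C * \<tau> k powr q) \<le> P k \<psi> - P k \<phi>"
            using elim(2) \<psi> z by (smt (verit))
          from mult_left_mono[OF this w0[of k]] 
          have "w k * \<tau> k / (4 * L) * (\<psi> z - \<phi> z) - w k * (c * (C * \<tau> k powr q)) \<le> w k * (P k \<psi> - P k \<phi>)"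
            by (simp add: right_diff_distrib)
          with 1 show "Q \<phi> + w k * \<tau> k / (4 * L) * (\<psi> z - \<phi> z) - (w k * (c * (C * \<tau> k powr q)) + \<eta>) \<le> Q \<psi>"
            by linarith
        qed
      qed
    qed
    from predual_norm_modulus[OF L Q this _ lev \<eta>] t x
    have "\<exists>Z\<in>cof. \<forall>z\<in>Z. N z = 1 \<longrightarrow> N (x + t *\<^sub>R z) \<le> 1 + (w k * (c * (C * \<tau> k powr q)) + \<eta>) + \<eta>"
      unfolding N_def by simp
    moreover have "w k * (c * (C * \<tau> k powr q)) + \<eta> + \<eta> \<le> K * t powr s"
    proof -
      have "c * C * (w k * \<tau> k powr q) \<le> c * C * ((A / \<beta>) powr s * t powr s)"
        using c C by (intro mult_left_mono err) auto
      then show ?thesis by (simp add: K_def \<eta>_def algebra_simps)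
    qed
    ultimately show ?thesis by (smt (verit))
  qed
  \<comment> \<open>Here \<open>t\<close> exceeds \<open>1 / A\<close>, and the triangle inequality
    is enough.\<close>
  have big: "\<exists>Z\<in>cof. \<forall>z\<in>Z. N z = 1 \<longrightarrow> N (x + t *\<^sub>R z) \<le> 1 + A powr s * t powr s"
    if t: "0 < t" "t < 1" "1 < A * t" and x: "N x = 1" for t x
  proof (intro bexI[OF _ UNIV_in_cof] ballI impI)
    fix z assume z: "N z = 1"
    have "N (x + t *\<^sub>R z) \<le> N x + N (t *\<^sub>R z)" "N (t *\<^sub>R z) = \<bar>t\<bar> * N z"
      using N unfolding equivalent_norm_def by blast+
    then have "N (x + t *\<^sub>R z) \<le> 1 + t" using x z t by simp
    moreover have "1 \<le> (A * t) powr s" using t s by (intro ge_one_powr_ge_zero) auto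
    moreover have "(A * t) powr s = A powr s * t powr s" using A t by (simp add: powr_mult)
    ultimately show "N (x + t *\<^sub>R z) \<le> 1 + A powr s * t powr s" using t by linarith
  qed
  have "aus_modulus N t \<le> (K + A powr s) * t powr s" if t: "0 < t" "t < 1" for t
  proof (rule aus_modulus_le[OF N inf])
    fix x assume x: "N x = 1"
    have "K * t powr s \<le> (K + A powr s) * t powr s" "A powr s * t powr s \<le> (K + A powr s) * t powr s"
      using K by (auto intro!: mult_right_mono)
    then show "\<exists>Z\<in>cof. \<forall>z\<in>Z. N z = 1 \<longrightarrow> N (x + t *\<^sub>R z) \<le> 1 + (K + A powr s) * t powr s"
      using small[OF t(1) _ x] big[OF t _ x] by (smt (verit))
  qed
  moreover have "0 < K + A powr s" using K by (simp add: add_pos_nonneg)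
  ultimately show ?thesis using N by (intro exI[of _ N] conjI exI[of _ "K + A powr s"]) auto
qed

end

section \<open>A common Lipschitz constant and the theorem\<close>

lemma coarse_lipschitz_max:
  assumes "coarse_lipschitz f"
  shows "\<exists>L. \<forall>L'\<ge>L. \<forall>x x'. norm (f x - f x') \<le> L' * norm (x - x') + L'"
proof -
  obtain L where L: "\<And>x x'. dist (f x) (f x') \<le> L * dist x x' + L"
    using assms by (auto simp: coarse_lipschitz_def)
  have "norm (f x - f x') \<le> L' * norm (x - x') + L'" if "L \<le> L'" for L' x x'
    using L[of x x'] that mult_right_mono[OF that, of "norm (x - x')"] by (simp add: dist_norm)
  then show ?thesis by blast
qed

theorem theorem2:
  fixes p :: ereal
  assumes "1 < p"
    and "AUS p (norm :: 'a::banach \<Rightarrow> real)"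
    and "asymptotically_coarse_lipschitz_equivalent TYPE('b::banach) TYPE('a)"
  shows "\<forall>p'\<in>{1<..<p}. AUSable p' TYPE('b)"
proof
  fix p' assume p': "p' \<in> {1<..<p}"
  obtain s where s: "p' = ereal s" "1 < s" using p' by (cases p') auto
  obtain q where q: "s < q" "ereal q \<le> p"
  proof (cases p)
    case (real r)
    then show ?thesis using that[of r] p' s by simp
  next
    case PInf
    then show ?thesis using that[of "s + 1"] by simp
  qed (use p' in auto)
  show "AUSable p' TYPE('b)"
  proof (cases "finite_dim_space TYPE('b)")
    case True
    have "equivalent_norm (norm :: 'b \<Rightarrow> real)"
      unfolding equivalent_norm_def
      by (intro conjI allI norm_triangle_ineq norm_scaleR norm_eq_zero exI[of _ 1]) simp_all
    moreover have "AUS p' (norm :: 'b \<Rightarrow> real)"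
      unfolding AUS_def aus_modulus_def using True s by (simp add: exI[of _ 1])
    ultimately show ?thesis unfolding AUSable_def by blast
  next
    case False
    obtain C where C: "0 < C" "\<And>\<tau> (x :: 'a). 0 < \<tau> \<Longrightarrow> \<tau> < 1 \<Longrightarrow> norm x = 1 \<Longrightarrow>
        \<exists>E\<in>cof. \<forall>e\<in>E. norm e \<le> \<tau> \<longrightarrow> norm (x + e) \<le> 1 + C * \<tau> powr q"
    proof -
      have "0 < q" using q s by linarith
      show thesis by (rule AUS_finite_codim[OF assms(2) \<open>0 < q\<close> q(2)], rule that) assumption+
    qed
    obtain G :: "'b \<Rightarrow> 'a" and F :: "'a \<Rightarrow> 'b" where GF: "coarse_lipschitz G" "coarse_lipschitz F"
      "asymptotically_close (F \<circ> G) id" "asymptotically_close (G \<circ> F) id"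
      using assms(3) by (auto simp: asymptotically_coarse_lipschitz_equivalent_def)
    obtain L1 L2 where L12: "\<And>L x x'. L1 \<le> L \<Longrightarrow> norm (G x - G x') \<le> L * norm (x - x') + L"
      "\<And>L x x'. L2 \<le> L \<Longrightarrow> norm (F x - F x') \<le> L * norm (x - x') + L"
      using coarse_lipschitz_max[OF GF(1)] coarse_lipschitz_max[OF GF(2)] by blast
    define L where "L = max 1 (max L1 L2)"
    interpret coarse_lipschitz_pair F G L
      by unfold_locales (auto simp: L_def intro!: L12)
    \<comment> \<open>A linear growth bound for both compositions, used near the base point, where
      the limit says nothing.\<close>
    have comp: "norm ((h \<circ> h') x - (h \<circ> h') 0) \<le> (L ^ 2 + L) * norm x + (L ^ 2 + L)"
      if "coarse_lipschitz_map h L" "coarse_lipschitz_map h' L"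
      for h :: "'c::real_normed_vector \<Rightarrow> 'd::real_normed_vector" and h' :: "'d \<Rightarrow> 'c" and x
    proof -
      interpret h: coarse_lipschitz_map h L by fact
      interpret h': coarse_lipschitz_map h' L by fact
      have "L * norm (h' x - h' 0) \<le> L * (L * norm x + L)"
        using h'.lip[of x 0] h.L by (intro mult_left_mono) auto
      moreover have "0 \<le> L * norm x" using h.L by simp
      ultimately show ?thesis
        using h.lip[of "h' x" "h' 0"] by (simp add: power2_eq_square algebra_simps)
    qed
    have "\<exists>N :: 'b \<Rightarrow> real. equivalent_norm N \<and> (\<exists>C>0. \<forall>\<tau>\<in>{0<..<1}. aus_modulus N \<tau> \<le> C * \<tau> powr s)"
    proof (rule equivalent_norm_modulus[OF _ _ False C(1) s(2) q(1) C(2)])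
      fix \<epsilon> K :: real assume *: "0 < \<epsilon>" "0 < K"
      show "\<forall>\<^sub>F R in at_top. \<forall>x. norm x \<le> K * R \<longrightarrow> norm (G (F x) - x) \<le> \<epsilon> * R"
        using asymptotically_close_idD[OF GF(4) comp *] F.coarse_lipschitz_map_axioms G.coarse_lipschitz_map_axioms by simp
      show "\<forall>\<^sub>F R in at_top. \<forall>x. norm x \<le> K * R \<longrightarrow> norm (F (G x) - x) \<le> \<epsilon> * R"
        using asymptotically_close_idD[OF GF(3) comp *] F.coarse_lipschitz_map_axioms G.coarse_lipschitz_map_axioms by simp
    qed
    then show ?thesis unfolding AUSable_def AUS_def s(1) by simp
  qed
qed

end
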